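(* Let $\mathcal{L}$ be a finite relational language and $\mathcal{H}$ a hereditary $\mathcal{L}$-property. Then either (a) $\mathrm{VC}^*_0(\mathcal H)<\infty$ and there is $K>0$ such that for all sufficiently large $n$, $|\mathcal H_n|\leq n^K$; or (b) $\mathrm{VC}^*_0(\mathcal H)=\infty$ and there is a constant $C>0$ such that for all sufficiently large $n$, $|\mathcal H_n|\geq 2^{Cn}$.
   Context: A hereditary $\mathcal{L}$-property is a class $\mathcal{H}$ of finite $\mathcal{L}$-structures closed under isomorphism and under (induced) substructures; $\mathcal{H}_n$ is the set of members of $\mathcal{H}$ with universe $[n]=\{1,\dots,n\}$. All formulas are quantifier-free $\mathcal{L}$-formulas; a partitioned formula $\varphi(\bar x;\bar y)$ has its free variables split into tuples $\bar x,\bar y$. Boxes: for a set $X$ and $t\geq 1$, a $(0,t)$-box (of any height) in $X$ is a singleton subset of $X^t$, and a $(0,0)$-box (of any height) is the empty set. The underlying set of a set of tuples is the set of all coordinates of its elements. Types: For $\mathbb{A}\subseteq X^{|\bar y|}$, a $\varphi$-type over $\mathbb A$ in the variables $\bar x$ is a maximal consistent subset of $\{\varphi(\bar x;\bar a),\neg\varphi(\bar x;\bar a):\bar a\in\mathbb A\}$; it is realized in an $\mathcal L$-structure $\mathcal M$ if $\mathbb A\subseteq M^{|\bar y|}$ and some $\bar b\in M^{|\bar x|}$ satisfies it. $S_\varphi(\mathbb A)$ is the set of $\varphi$-types over $\mathbb A$ realized in some member of $\mathcal H$. $S^{\emptyset}_n(\mathbb A)$ is the set of complete types in $n$ variables in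 the pure language of equality with parameters from the underlying set of $\mathbb A$. For $m\geq 1$ and $\rho\in S^\emptyset_{2|\bar x|}(\mathbb A)$, $S_{\varphi,m}(\mathbb A,\rho)$ is the set of all unions $p_1(\bar x_1)\cup\dots\cup p_m(\bar x_m)$ ($\bar x_i$ disjoint copies of $\bar x$), each $p_i\in S_\varphi(\mathbb A)$, such that there exist $\mathcal M\in\mathcal H$ and pairwise distinct $\bar a_1,\dots,\bar a_m\in M^{|\bar x|}$ with $\bar a_i$ realizing $p_i$ for each $i$ and $\rho(\bar a_i,\bar a_j)$ holding in $\mathcal M$ for all $i\neq j$. $\mathrm{VC}^*_0(\varphi,\mathcal H)$ is the supremum of all $m\in\mathbb N$ such that for some $(0,|\bar y|)$-box $\mathbb A$ (in some set) and some $\rho\in S^\emptyset_{2|\bar x|}(\mathbb A)$, $|S_{\varphi,m}(\mathbb A,\rho)|=2^{m}$. $\mathrm{VC}^*_0(\mathcal H)$ is the supremum of $\mathrm{VC}^*_0(\varphi,\mathcal H)$ over all quantifier-free partitioned formulas $\varphi(\bar x;\bar y)$. *)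

theory Defs
  imports Complex_Main "HOL-Library.Extended_Nat"
begin

record 'r lang =
  syms :: "'r set"
  arity :: "'r \<Rightarrow> nat"

text \<open>
  All structures have their universe inside the type of natural numbers. A class of finite
  structures that is closed under isomorphism is determined by these members, and the
  parameters of the types considered below form a finite set, so nothing is lost.
\<close>

record 'r lstruct =
  univ :: "nat set"
  interp :: "'r \<Rightarrow> nat list set"

definition tuples :: "nat \<Rightarrow> 'a set \<Rightarrow> 'a list set" where
  "tuples k X = {xs. length xs = k \<and> set xs \<subseteq> X}"

text \<open>
  Interpreting symbols outside the language by the empty set makes two structures with the
  same universe and the same relations equal, so that structures can be counted.
\<close>

definition is_lstruct :: "'r lang \<Rightarrow> 'r lstruct \<Rightarrow> bool" where
  "is_lstruct L M \<longleftrightarrow> univ M \<noteq> {} \<and>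
     (\<forall>r\<in>syms L. interp M r \<subseteq> tuples (arity L r) (univ M)) \<and>
     (\<forall>r. r \<notin> syms L \<longrightarrow> interp M r = {})"

definition lstruct_iso :: "'r lang \<Rightarrow> 'r lstruct \<Rightarrow> 'r lstruct \<Rightarrow> bool" where
  "lstruct_iso L M N \<longleftrightarrow> (\<exists>f. bij_betw f (univ M) (univ N) \<and>
     (\<forall>r\<in>syms L. \<forall>xs\<in>tuples (arity L r) (univ M).
        xs \<in> interp M r \<longleftrightarrow> map f xs \<in> interp N r))"

definition induced :: "'r lstruct \<Rightarrow> nat set \<Rightarrow> 'r lstruct" where
  "induced M S = \<lparr>univ = S, interp = (\<lambda>r. {xs \<in> interp M r. set xs \<subseteq> S})\<rparr>"

definition hereditary :: "'r lang \<Rightarrow> 'r lstruct set \<Rightarrow> bool" where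
  "hereditary L H \<longleftrightarrow>
     (\<forall>M\<in>H. is_lstruct L M \<and> finite (univ M)) \<and>
     (\<forall>M\<in>H. \<forall>N. is_lstruct L N \<and> lstruct_iso L M N \<longrightarrow> N \<in> H) \<and>
     (\<forall>M\<in>H. \<forall>S. S \<noteq> {} \<and> S \<subseteq> univ M \<longrightarrow> induced M S \<in> H)"

definition members_on :: "'r lstruct set \<Rightarrow> nat \<Rightarrow> 'r lstruct set" where
  "members_on H n = {M \<in> H. univ M = {1..n}}"

text \<open>Quantifier-free formulas; the remaining connectives are definable from these.\<close>

datatype (dead 'r, terms: 't) qf =
    Equal 't 't
  | Atom 'r "'t list"
  | Bot
  | Neg "('r, 't) qf"
  | Conj "('r, 't) qf" "('r, 't) qf"
  for map: subst_qf

datatype 'v trm = Var 'v | Par nat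

datatype pvar = X nat | Y nat

primrec wf_qf :: "'r lang \<Rightarrow> ('r, 't) qf \<Rightarrow> bool" where
  "wf_qf L (Equal s t) \<longleftrightarrow> True"
| "wf_qf L (Atom r ts) \<longleftrightarrow> r \<in> syms L \<and> length ts = arity L r"
| "wf_qf L Bot \<longleftrightarrow> True"
| "wf_qf L (Neg \<phi>) \<longleftrightarrow> wf_qf L \<phi>"
| "wf_qf L (Conj \<phi> \<psi>) \<longleftrightarrow> wf_qf L \<phi> \<and> wf_qf L \<psi>"

primrec trm_val :: "('v \<Rightarrow> nat) \<Rightarrow> 'v trm \<Rightarrow> nat" where
  "trm_val s (Var v) = s v"
| "trm_val s (Par a) = a"

primrec sat :: "'r lstruct \<Rightarrow> ('v \<Rightarrow> nat) \<Rightarrow> ('r, 'v trm) qf \<Rightarrow> bool" where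
  "sat M s (Equal t u) \<longleftrightarrow> trm_val s t = trm_val s u"
| "sat M s (Atom r ts) \<longleftrightarrow> map (trm_val s) ts \<in> interp M r"
| "sat M s Bot \<longleftrightarrow> False"
| "sat M s (Neg \<phi>) \<longleftrightarrow> \<not> sat M s \<phi>"
| "sat M s (Conj \<phi> \<psi>) \<longleftrightarrow> sat M s \<phi> \<and> sat M s \<psi>"

text \<open>\<open>pformula L k l \<phi>\<close>: \<open>\<phi>(x; y)\<close> is partitioned with \<open>|x| = k\<close> and \<open>|y| = l\<close>.\<close>

definition pformula :: "'r lang \<Rightarrow> nat \<Rightarrow> nat \<Rightarrow> ('r, pvar) qf \<Rightarrow> bool" where
  "pformula L k l \<phi> \<longleftrightarrow> wf_qf L \<phi> \<and> terms \<phi> \<subseteq> X ` {..<k} \<union> Y ` {..<l}"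

text \<open>\<open>inst \<phi> a\<close> is \<open>\<phi>(x; a)\<close>, a formula with parameters.\<close>

definition inst :: "('r, pvar) qf \<Rightarrow> nat list \<Rightarrow> ('r, nat trm) qf" where
  "inst \<phi> a = subst_qf (case_pvar Var (\<lambda>j. Par (a ! j))) \<phi>"

definition underlying :: "'a list set \<Rightarrow> 'a set" where
  "underlying A = (\<Union>a\<in>A. set a)"

definition zero_box :: "nat \<Rightarrow> 'a set \<Rightarrow> 'a list set \<Rightarrow> bool" where
  "zero_box t S A \<longleftrightarrow> (if t = 0 then A = {} else \<exists>a\<in>tuples t S. A = {a})"

text \<open>
  The tuple \<open>b\<close> of length \<open>n\<close> realizes in \<open>M\<close> the set \<open>p\<close> of formulas with parameters from \<open>P\<close>.
  For \<open>P = underlying A\<close>, where \<open>A\<close> consists of tuples of length \<open>l\<close>, the condition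
  \<open>P \<subseteq> univ M\<close> says \<open>A \<subseteq> tuples l (univ M)\<close>.
\<close>

definition realizes ::
    "nat set \<Rightarrow> nat \<Rightarrow> 'r lstruct \<Rightarrow> nat list \<Rightarrow> ('r, nat trm) qf set \<Rightarrow> bool" where
  "realizes P n M b p \<longleftrightarrow>
     P \<subseteq> univ M \<and> b \<in> tuples n (univ M) \<and> (\<forall>\<psi>\<in>p. sat M ((!) b) \<psi>)"

definition consistent :: "'r lang \<Rightarrow> nat set \<Rightarrow> nat \<Rightarrow> ('r, nat trm) qf set \<Rightarrow> bool" where
  "consistent L P n p \<longleftrightarrow> (\<exists>M b. is_lstruct L M \<and> realizes P n M b p)"

definition maximal_consistent ::
    "'r lang \<Rightarrow> nat set \<Rightarrow> nat \<Rightarrow> ('r, nat trm) qf set \<Rightarrow> ('r, nat trm) qf set \<Rightarrow> bool" where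
  "maximal_consistent L P n F p \<longleftrightarrow> p \<subseteq> F \<and> consistent L P n p \<and>
     (\<forall>q. p \<subset> q \<and> q \<subseteq> F \<longrightarrow> \<not> consistent L P n q)"

definition phi_type ::
    "'r lang \<Rightarrow> nat \<Rightarrow> ('r, pvar) qf \<Rightarrow> nat list set \<Rightarrow> ('r, nat trm) qf set \<Rightarrow> bool" where
  "phi_type L k \<phi> A p \<longleftrightarrow>
     maximal_consistent L (underlying A) k (inst \<phi> ` A \<union> (\<lambda>a. Neg (inst \<phi> a)) ` A) p"

definition S_phi ::
    "'r lang \<Rightarrow> 'r lstruct set \<Rightarrow> nat \<Rightarrow> ('r, pvar) qf \<Rightarrow> nat list set
     \<Rightarrow> ('r, nat trm) qf set set" where
  "S_phi L H k \<phi> A =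
     {p. phi_type L k \<phi> A p \<and> (\<exists>M\<in>H. \<exists>b. realizes (underlying A) k M b p)}"

definition eq_lang :: "'r lang" where
  "eq_lang = \<lparr>syms = {}, arity = (\<lambda>_. 0)\<rparr>"

definition S_empty :: "nat \<Rightarrow> nat list set \<Rightarrow> ('r, nat trm) qf set set" where
  "S_empty n A = {\<rho>. maximal_consistent eq_lang (underlying A) n
     {\<psi>. wf_qf eq_lang \<psi> \<and> terms \<psi> \<subseteq> Var ` {..<n} \<union> Par ` underlying A} \<rho>}"

text \<open>The \<open>i\<close>-th disjoint copy of the variables \<open>x\<close> consists of the variables \<open>(i, j)\<close>.\<close>

definition copy :: "nat \<Rightarrow> ('r, nat trm) qf \<Rightarrow> ('r, (nat \<times> nat) trm) qf" where
  "copy i \<psi> = subst_qf (map_trm (Pair i)) \<psi>"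

text \<open>
  In \<open>\<rho>\<close> the first copy of the variables \<open>x\<close> is \<open>Var 0, \<dots>, Var (k - 1)\<close> and the second
  copy is \<open>Var k, \<dots>, Var (2 * k - 1)\<close>.
\<close>

definition S_phi_m ::
    "'r lang \<Rightarrow> 'r lstruct set \<Rightarrow> nat \<Rightarrow> ('r, pvar) qf \<Rightarrow> nat \<Rightarrow> nat list set
     \<Rightarrow> ('r, nat trm) qf set \<Rightarrow> ('r, (nat \<times> nat) trm) qf set set" where
  "S_phi_m L H k \<phi> m A \<rho> =
     {(\<Union>i<m. copy i ` p i) | p.
        (\<forall>i<m. p i \<in> S_phi L H k \<phi> A) \<and>
        (\<exists>M\<in>H. \<exists>a. inj_on a {..<m} \<and>
           (\<forall>i<m. realizes (underlying A) k M (a i) (p i)) \<and>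
           (\<forall>i<m. \<forall>j<m. i \<noteq> j \<longrightarrow> realizes (underlying A) (2 * k) M (a i @ a j) \<rho>))}"

definition VC0_phi ::
    "'r lang \<Rightarrow> 'r lstruct set \<Rightarrow> nat \<Rightarrow> nat \<Rightarrow> ('r, pvar) qf \<Rightarrow> enat" where
  "VC0_phi L H k l \<phi> = Sup {enat m | m. m \<ge> 1 \<and>
     (\<exists>S A \<rho>. zero_box l S A \<and> \<rho> \<in> S_empty (2 * k) A \<and>
        card (S_phi_m L H k \<phi> m A \<rho>) = 2 ^ m)}"

definition VC0 :: "'r lang \<Rightarrow> 'r lstruct set \<Rightarrow> enat" where
  "VC0 L H = Sup {VC0_phi L H k l \<phi> | k l \<phi>. pformula L k l \<phi>}"

end

theory Submission
  imports Defs "HOL-Library.Disjoint_Sets"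
begin

text \<open>
  Call a structure \<open>s\<close>-split if some atomic formula, with parameters, holds at \<open>s\<close> and fails at
  another \<open>s\<close> tuples of distinct elements, all \<open>2 s\<close> tuples being pairwise disjoint and disjoint
  from the parameters. The dichotomy is whether \<open>H\<close> has \<open>s\<close>-split members for every \<open>s\<close>.

  If it does, every pattern of truth values along \<open>s\<close> tuples occurs inside a single member, always
  with the same equality type; so the dual dimension is infinite, and the induced substructures on
  the chosen tuples, relabelled by \<open>{1..n}\<close>, encode \<open>2 ^ (c n)\<close> patterns.

  If it does not, a maximal disjoint family of tuples on which a formula takes its exceptional value
  is small, and its union meets every exceptional tuple. Adding these unions to a set of parameters
  a bounded number of times yields a bounded set \<open>D\<close> such that every relation depends only on the
  equality type over \<open>D\<close>. Then there are polynomially many structures, and in a pattern of length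
  \<open>m > 2 |D| + 2\<close> two tuples with opposite truth values have the same equality type over \<open>D\<close>
  and the parameters.
\<close>

section \<open>Tuples, argument templates and split structures\<close>

lemma card_tuples: "finite S \<Longrightarrow> card (tuples n S) = card S ^ n"
  using card_lists_length_eq[of S n] by (simp add: tuples_def conj_commute)

lemma finite_tuples: "finite S \<Longrightarrow> finite (tuples n S)"
  using finite_lists_length_eq[of S n] by (simp add: tuples_def conj_commute)

text \<open>The \<open>Suc\<close> makes the bound positive and strictly larger than every arity, as
  the pigeonhole argument along a chain of this length requires.\<close>

definition arity_bound :: "'r lang \<Rightarrow> nat" where
  "arity_bound L = Suc (\<Sum>R\<in>syms L. arity L R)"

lemma arity_less_bound:
  assumes "finite (syms L)" and "R \<in> syms L"
  shows "arity L R < arity_bound L"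
  using member_le_sum[of R "syms L" "arity L"] assms by (simp add: arity_bound_def)

definition plug :: "nat list \<Rightarrow> nat trm list \<Rightarrow> nat list" where
  "plug e ts = map (trm_val ((!) e)) ts"

text \<open>Argument lists of atomic formulas with parameters from \<open>P\<close>. For given
  \<open>R\<close> and \<open>k\<close> their number is bounded in terms of
  \<open>card P\<close>.\<close>

definition templates :: "'r lang \<Rightarrow> 'r \<Rightarrow> nat \<Rightarrow> nat set \<Rightarrow> nat trm list set" where
  "templates L R k P = tuples (arity L R) (Var ` {..<k} \<union> Par ` P)"

text \<open>Nonempty \<open>P\<close> matters because a \<open>zero_box\<close> of tuples of length
  0 is empty and carries no instance of a formula. The bound \<open>1 \<le> k\<close> makes disjoint
  tuples different, and \<open>k \<le> arity_bound L\<close> enters the exponential lower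
  bound.\<close>

definition splits :: "'r lang \<Rightarrow> 'r lstruct \<Rightarrow> nat \<Rightarrow> bool" where
  "splits L M s \<longleftrightarrow> (\<exists>R\<in>syms L. \<exists>k P ts b.
     1 \<le> k \<and> k \<le> arity_bound L \<and> P \<noteq> {} \<and> P \<subseteq> univ M \<and> ts \<in> templates L R k P \<and>
     (\<forall>i<2 * s. b i \<in> tuples k (univ M - P) \<and> distinct (b i) \<and>
        (plug (b i) ts \<in> interp M R \<longleftrightarrow> i < s)) \<and>
     disjoint_family_on (\<lambda>i. set (b i)) {..<2 * s})"

section \<open>Small transversals and settled truth values\<close>

text \<open>If a disjoint family of \<open>s\<close> tuples from \<open>A\<close> cannot be
  extended, its at most \<open>s * k\<close> entries already meet every member of
  \<open>A\<close>.\<close>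

lemma disjoint_tuples_or_transversal:
  fixes A :: "'a list set"
  assumes len: "\<And>e. e \<in> A \<Longrightarrow> length e = k"
  shows "(\<exists>b. (\<forall>i<s. b i \<in> A) \<and> disjoint_family_on (\<lambda>i. set (b i)) {..<s}) \<or>
    (\<exists>U. finite U \<and> card U \<le> s * k \<and> U \<subseteq> (\<Union>e\<in>A. set e) \<and> (\<forall>e\<in>A. set e \<inter> U \<noteq> {}))"
proof (induction s)
  case 0
  show ?case by (simp add: disjoint_family_on_def)
next
  case (Suc s)
  then consider
    (fam) b where "\<forall>i<s. b i \<in> A" "disjoint_family_on (\<lambda>i. set (b i)) {..<s}"
    | (hit) U where "finite U" "card U \<le> s * k" "U \<subseteq> (\<Union>e\<in>A. set e)" "\<forall>e\<in>A. set e \<inter> U \<noteq> {}"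
    by blast
  then show ?case
  proof cases
    case fam
    define U where "U = (\<Union>i<s. set (b i))"
    have "card U \<le> (\<Sum>i<s. card (set (b i)))"
      unfolding U_def by (rule card_UN_le) simp
    also have "\<dots> \<le> (\<Sum>i<s. k)"
      using fam(1) len by (intro sum_mono) (metis card_length lessThan_iff)
    finally have cU: "card U \<le> Suc s * k" by simp
    show ?thesis
    proof (cases "\<exists>e\<in>A. set e \<inter> U = {}")
      case True
      then obtain e where e: "e \<in> A" "set e \<inter> U = {}" by blast
      have "disjoint_family_on (\<lambda>i. set ((b(s := e)) i)) {..<Suc s}"
        using fam(2) e(2) unfolding disjoint_family_on_def U_def
        by (fastforce simp: less_Suc_eq)
      moreover have "\<forall>i<Suc s. (b(s := e)) i \<in> A"
        using fam(1) e(1) by (simp add: less_Suc_eq)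
      ultimately show ?thesis by blast
    next
      case False
      moreover have "finite U" "U \<subseteq> (\<Union>e\<in>A. set e)" using fam(1) by (auto simp: U_def)
      ultimately show ?thesis using cU by blast
    qed
  next
    case hit
    then have "card U \<le> Suc s * k" by simp
    with hit show ?thesis by blast
  qed
qed

text \<open>If the true tuples have a small transversal, the value off it is false. Otherwise fix
  \<open>s\<close> disjoint true tuples with union \<open>U\<close>. The false tuples avoiding
  \<open>U\<close> then have a small transversal \<open>V\<close>, and the value off
  \<open>U \<union> V\<close> is true. Each of the two sets costs at most
  \<open>s * k\<close>.\<close>

lemma template_constant_off_small_set:
  assumes ns: "\<not> splits L M s" and R: "R \<in> syms L" and k: "1 \<le> k" "k \<le> arity_bound L"
    and P: "P \<noteq> {}" "P \<subseteq> univ M" and ts: "ts \<in> templates L R k P"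
  shows "\<exists>U v. U \<subseteq> univ M \<and> card U \<le> 2 * s * k \<and>
    (\<forall>e\<in>tuples k (univ M - (P \<union> U)). distinct e \<longrightarrow> (plug e ts \<in> interp M R \<longleftrightarrow> v))"
proof -
  define A where "A v = {e \<in> tuples k (univ M - P). distinct e \<and> (plug e ts \<in> interp M R \<longleftrightarrow> v)}" for v
  have lenA: "e \<in> A v \<Longrightarrow> length e = k" for e v by (auto simp: A_def tuples_def)
  have subA: "(\<Union>e\<in>A v. set e) \<subseteq> univ M" for v by (auto simp: A_def tuples_def)
  have notin: "e \<in> A (plug e ts \<in> interp M R)" "set e \<inter> U = {}"
    if "e \<in> tuples k (univ M - (P \<union> U))" "distinct e" for e U
    using that by (auto simp: A_def tuples_def)
  have "(\<exists>b. (\<forall>i<s. b i \<in> A True) \<and> disjoint_family_on (\<lambda>i. set (b i)) {..<s}) \<or>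
    (\<exists>U. finite U \<and> card U \<le> s * k \<and> U \<subseteq> (\<Union>e\<in>A True. set e) \<and> (\<forall>e\<in>A True. set e \<inter> U \<noteq> {}))"
    by (rule disjoint_tuples_or_transversal) (rule lenA)
  then consider
    (fam) b where "\<forall>i<s. b i \<in> A True" "disjoint_family_on (\<lambda>i. set (b i)) {..<s}"
    | (hit) U where "card U \<le> s * k" "U \<subseteq> (\<Union>e\<in>A True. set e)" "\<forall>e\<in>A True. set e \<inter> U \<noteq> {}"
    by (elim disjE exE conjE) auto
  then show ?thesis
  proof cases
    case hit
    have "\<forall>e\<in>tuples k (univ M - (P \<union> U)). distinct e \<longrightarrow> (plug e ts \<in> interp M R \<longleftrightarrow> False)"
    proof (intro ballI impI)
      fix e assume e: "e \<in> tuples k (univ M - (P \<union> U))" "distinct e"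
      show "plug e ts \<in> interp M R \<longleftrightarrow> False"
        using hit(3) notin[OF e] by auto
    qed
    moreover have "U \<subseteq> univ M" using hit(2) subA by blast
    ultimately show ?thesis using hit(1) by (intro exI[of _ U] exI[of _ False]) auto
  next
    case fam
    define U where "U = (\<Union>i<s. set (b i))"
    have "card U \<le> (\<Sum>i<s. card (set (b i)))"
      unfolding U_def by (rule card_UN_le) simp
    also have "\<dots> \<le> (\<Sum>i<s. k)"
      using fam(1) lenA by (intro sum_mono) (metis card_length lessThan_iff)
    finally have cU: "card U \<le> s * k" by simp
    have sU: "U \<subseteq> univ M" using fam(1) subA by (auto simp: U_def)
    \<comment> \<open>Any \<open>s\<close> disjoint tuples of \<open>A'\<close> are also disjoint
      from the \<open>s\<close> true ones, so together they would witness
      \<open>splits L M s\<close>.\<close>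
    define A' where "A' = {e \<in> A False. set e \<inter> U = {}}"
    have no: "\<not> ((\<forall>i<s. c i \<in> A') \<and> disjoint_family_on (\<lambda>i. set (c i)) {..<s})" for c
    proof
      assume c: "(\<forall>i<s. c i \<in> A') \<and> disjoint_family_on (\<lambda>i. set (c i)) {..<s}"
      define d where "d i = (if i < s then b i else c (i - s))" for i
      have "d i \<in> A (i < s)" if "i < 2 * s" for i
        using that fam(1) c by (auto simp: d_def A'_def)
      then have "\<forall>i<2 * s. d i \<in> tuples k (univ M - P) \<and> distinct (d i) \<and>
          (plug (d i) ts \<in> interp M R \<longleftrightarrow> i < s)"
        by (auto simp: A_def)
      moreover have "disjoint_family_on (\<lambda>i. set (d i)) {..<2 * s}"
        unfolding disjoint_family_on_def
      proof (intro ballI impI)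
        fix i j assume ij: "i \<in> {..<2 * s}" "j \<in> {..<2 * s}" "i \<noteq> j"
        have bc: "set (b i) \<inter> set (c j) = {}" if "i < s" "j < s" for i j
          using c that by (auto simp: A'_def U_def)
        consider "i < s" "j < s" | "i < s" "\<not> j < s" | "\<not> i < s" "j < s" | "\<not> i < s" "\<not> j < s"
          by blast
        then show "set (d i) \<inter> set (d j) = {}"
        proof cases
          case 1
          with ij fam(2) show ?thesis by (simp add: d_def disjoint_family_on_def)
        next
          case 2
          then show ?thesis using ij bc[of i "j - s"] by (simp add: d_def)
        next
          case 3
          then have "set (b j) \<inter> set (c (i - s)) = {}" using ij by (intro bc) auto
          with 3 show ?thesis by (auto simp: d_def)
        next
          case 4
          then have "i - s < s" "j - s < s" "i - s \<noteq> j - s" using ij by auto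
          with 4 c show ?thesis by (simp add: d_def disjoint_family_on_def)
        qed
      qed
      ultimately have "splits L M s"
        unfolding splits_def using R k P ts
        by (intro bexI[OF _ R] exI[of _ k] exI[of _ P] exI[of _ ts] exI[of _ d] conjI)
      with ns show False by simp
    qed
    obtain V where V: "card V \<le> s * k" "V \<subseteq> (\<Union>e\<in>A'. set e)" "\<forall>e\<in>A'. set e \<inter> V \<noteq> {}"
    proof -
      have "(\<exists>b. (\<forall>i<s. b i \<in> A') \<and> disjoint_family_on (\<lambda>i. set (b i)) {..<s}) \<or>
        (\<exists>V. finite V \<and> card V \<le> s * k \<and> V \<subseteq> (\<Union>e\<in>A'. set e) \<and> (\<forall>e\<in>A'. set e \<inter> V \<noteq> {}))"
        by (rule disjoint_tuples_or_transversal, rule lenA[of _ False]) (simp add: A'_def)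
      then show ?thesis using no that by (elim disjE exE conjE) auto
    qed
    have "V \<subseteq> univ M" using V(2) subA[of False] by (auto simp: A'_def)
    moreover have "card (U \<union> V) \<le> 2 * s * k"
      using card_Un_le[of U V] cU V(1) by simp
    moreover have "\<forall>e\<in>tuples k (univ M - (P \<union> (U \<union> V))). distinct e \<longrightarrow> (plug e ts \<in> interp M R \<longleftrightarrow> True)"
    proof (intro ballI impI)
      fix e assume e: "e \<in> tuples k (univ M - (P \<union> (U \<union> V)))" "distinct e"
      have disj: "set e \<inter> U = {}" "set e \<inter> V = {}" using notin(2)[OF e] by auto
      show "plug e ts \<in> interp M R \<longleftrightarrow> True"
      proof (rule ccontr)
        assume "\<not> ?thesis"
        then have "e \<in> A'" using notin(1)[OF e] disj(1) by (simp add: A'_def)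
        with V(3) disj(2) show False by blast
      qed
    qed
    ultimately show ?thesis using sU by (intro exI[of _ "U \<union> V"] exI[of _ True]) auto
  qed
qed

text \<open>Parameters come from the smaller set \<open>P\<close>, while the tuples avoid the larger
  set \<open>Q\<close>. Nothing is said about tuples that meet the layer between them.\<close>

definition settles :: "'r lang \<Rightarrow> 'r lstruct \<Rightarrow> nat set \<Rightarrow> nat set \<Rightarrow> bool" where
  "settles L M P Q \<longleftrightarrow> P \<subseteq> Q \<and>
     (\<forall>R\<in>syms L. \<forall>k\<in>{1..arity_bound L}. \<forall>ts\<in>templates L R k P. \<exists>v.
        \<forall>e\<in>tuples k (univ M - Q). distinct e \<longrightarrow> (plug e ts \<in> interp M R \<longleftrightarrow> v))"

text \<open>There are boundedly many templates over \<open>P\<close>, and each has a small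
  exceptional set. Adding all of these to \<open>P\<close> gives a bound that does not depend on
  \<open>M\<close>.\<close>

lemma bounded_settling_step:
  fixes L :: "'r lang"
  assumes fin: "finite (syms L)"
  shows "\<exists>c. \<forall>M P. \<not> splits L M s \<and> finite (univ M) \<and> P \<noteq> {} \<and> P \<subseteq> univ M \<and> card P \<le> b \<longrightarrow>
    (\<exists>Q. settles L M P Q \<and> Q \<subseteq> univ M \<and> card Q \<le> c)"
proof -
  define q where "q = arity_bound L"
  \<comment> \<open>\<open>b\<close> bounds \<open>P\<close>, the middle factor bounds the number of
    triples of symbol, length and template, and \<open>2 * s * q\<close> bounds each exceptional
    set.\<close>
  define c where "c = b + card (syms L) * (q * (q + b) ^ q) * (2 * s * q)"
  show ?thesis
  proof (intro exI[of _ c] allI impI)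
    fix M :: "'r lstruct" and P
    assume asm: "\<not> splits L M s \<and> finite (univ M) \<and> P \<noteq> {} \<and> P \<subseteq> univ M \<and> card P \<le> b"
    then have finP: "finite P" using finite_subset by auto
    define I where "I = (SIGMA R:syms L. SIGMA k:{1..q}. templates L R k P)"
    have fint: "finite (templates L R k P)" for R k
      unfolding templates_def using finP by (simp add: finite_tuples)
    have finI: "finite I" unfolding I_def using fin fint by (intro finite_SigmaI) auto
    have ct: "card (templates L R k P) \<le> (q + b) ^ q" if "R \<in> syms L" "k \<in> {1..q}" for R k
    proof -
      have q: "1 \<le> q" by (simp add: q_def arity_bound_def)
      have "card (Var ` {..<k} \<union> Par ` P :: nat trm set) \<le> card (Var ` {..<k} :: nat trm set) + card (Par ` P :: nat trm set)"
        by (rule card_Un_le)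
      also have "\<dots> \<le> k + card P"
        using card_image_le[of "{..<k}" "Var :: nat \<Rightarrow> nat trm"] card_image_le[OF finP, of "Par :: nat \<Rightarrow> nat trm"] by simp
      also have "\<dots> \<le> q + b" using that asm by auto
      finally have "card (templates L R k P) \<le> (q + b) ^ arity L R"
        unfolding templates_def using finP by (subst card_tuples) (auto intro: power_mono)
      also have "\<dots> \<le> (q + b) ^ q"
        using q arity_less_bound[OF fin that(1)] by (intro power_increasing) (auto simp: q_def)
      finally show ?thesis .
    qed
    have "card I = (\<Sum>R\<in>syms L. \<Sum>k\<in>{1..q}. card (templates L R k P))"
      unfolding I_def using fin fint by (subst card_SigmaI) auto
    also have "\<dots> \<le> (\<Sum>R\<in>syms L. \<Sum>k\<in>{1..q}. (q + b) ^ q)"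
      using ct by (intro sum_mono) auto
    finally have cI: "card I \<le> card (syms L) * (q * (q + b) ^ q)" by simp
    have "\<exists>U v. U \<subseteq> univ M \<and> card U \<le> 2 * s * q \<and>
      (\<forall>e\<in>tuples k (univ M - (P \<union> U)). distinct e \<longrightarrow> (plug e ts \<in> interp M R \<longleftrightarrow> v))"
      if "(R, k, ts) \<in> I" for R k ts
    proof -
      have k: "1 \<le> k" "k \<le> q" using that by (auto simp: I_def)
      have "2 * s * k \<le> 2 * s * q" using k by simp
      moreover have "\<exists>U v. U \<subseteq> univ M \<and> card U \<le> 2 * s * k \<and>
        (\<forall>e\<in>tuples k (univ M - (P \<union> U)). distinct e \<longrightarrow> (plug e ts \<in> interp M R \<longleftrightarrow> v))"
        by (rule template_constant_off_small_set) (use that asm k in \<open>auto simp: I_def q_def\<close>)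
      ultimately show ?thesis by (elim exE conjE) (rule exI, rule exI, intro conjI, assumption, rule order_trans, assumption+)
    qed
    then have "\<forall>x\<in>I. \<exists>U. U \<subseteq> univ M \<and> card U \<le> 2 * s * q \<and> (\<exists>v. 
      (\<forall>e\<in>tuples (fst (snd x)) (univ M - (P \<union> U)). distinct e \<longrightarrow> (plug e (snd (snd x)) \<in> interp M (fst x) \<longleftrightarrow> v)))"
      by fastforce
    then obtain U where U: "\<forall>x\<in>I. U x \<subseteq> univ M \<and> card (U x) \<le> 2 * s * q \<and> (\<exists>v. 
      (\<forall>e\<in>tuples (fst (snd x)) (univ M - (P \<union> U x)). distinct e \<longrightarrow> (plug e (snd (snd x)) \<in> interp M (fst x) \<longleftrightarrow> v)))"
      by metis
    define Q where "Q = P \<union> (\<Union>x\<in>I. U x)"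
    have "card (\<Union>x\<in>I. U x) \<le> (\<Sum>x\<in>I. card (U x))" by (rule card_UN_le[OF finI])
    also have "\<dots> \<le> (\<Sum>x\<in>I. 2 * s * q)" using U by (intro sum_mono) blast
    also have "\<dots> \<le> card (syms L) * (q * (q + b) ^ q) * (2 * s * q)"
      using cI by simp
    finally have "card Q \<le> c"
      unfolding Q_def c_def using card_Un_le[of P "\<Union>x\<in>I. U x"] asm by linarith
    moreover have "Q \<subseteq> univ M" using U asm by (auto simp: Q_def)
    moreover have "settles L M P Q"
      unfolding settles_def
    proof (intro conjI ballI)
      show "P \<subseteq> Q" by (simp add: Q_def)
      fix R k ts assume "R \<in> syms L" "k \<in> {1..arity_bound L}" "ts \<in> templates L R k P"
      then have x: "(R, k, ts) \<in> I" by (simp add: I_def q_def)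
      then obtain v where v: "\<forall>e\<in>tuples k (univ M - (P \<union> U (R, k, ts))). distinct e \<longrightarrow> (plug e ts \<in> interp M R \<longleftrightarrow> v)"
        using U by fastforce
      have "tuples k (univ M - Q) \<subseteq> tuples k (univ M - (P \<union> U (R, k, ts)))"
        using x by (auto simp: tuples_def Q_def)
      then have "\<forall>e\<in>tuples k (univ M - Q). distinct e \<longrightarrow> (plug e ts \<in> interp M R \<longleftrightarrow> v)"
        using bspec[OF v] by (simp add: subset_iff)
      then show "\<exists>v. \<forall>e\<in>tuples k (univ M - Q). distinct e \<longrightarrow> (plug e ts \<in> interp M R \<longleftrightarrow> v)"
        by (rule exI)
    qed
    ultimately show "\<exists>Q. settles L M P Q \<and> Q \<subseteq> univ M \<and> card Q \<le> c" by blast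
  qed
qed

text \<open>The bound for the next set comes from \<open>bounded_settling_step\<close> at the
  current bound, so it depends on \<open>i\<close> but not on \<open>M\<close>. The chain starts
  with a single element because parameter sets must be nonempty.\<close>

lemma bounded_settling_chain:
  fixes L :: "'r lang"
  assumes fin: "finite (syms L)"
  shows "\<exists>B. \<forall>M. \<not> splits L M s \<and> finite (univ M) \<and> univ M \<noteq> {} \<longrightarrow>
    (\<exists>D. (\<forall>j<i. settles L M (D j) (D (Suc j))) \<and> D i \<noteq> {} \<and> D i \<subseteq> univ M \<and> card (D i) \<le> B)"
proof (induction i)
  case 0
  show ?case
  proof (intro exI[of _ 1] allI impI)
    fix M :: "'r lstruct"
    assume "\<not> splits L M s \<and> finite (univ M) \<and> univ M \<noteq> {}"
    then obtain x where "x \<in> univ M" by blast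
    then show "\<exists>D. (\<forall>j<0. settles L M (D j) (D (Suc j))) \<and> D 0 \<noteq> {} \<and> D 0 \<subseteq> univ M \<and> card (D 0) \<le> 1"
      by (intro exI[of _ "\<lambda>_. {x}"]) auto
  qed
next
  case (Suc i)
  then obtain B where B: "\<forall>M. \<not> splits L M s \<and> finite (univ M) \<and> univ M \<noteq> {} \<longrightarrow>
    (\<exists>D. (\<forall>j<i. settles L M (D j) (D (Suc j))) \<and> D i \<noteq> {} \<and> D i \<subseteq> univ M \<and> card (D i) \<le> B)"
    by (elim exE)
  obtain c where c: "\<forall>M P. \<not> splits L M s \<and> finite (univ M) \<and> P \<noteq> {} \<and> P \<subseteq> univ M \<and> card P \<le> B \<longrightarrow>
    (\<exists>Q. settles L M P Q \<and> Q \<subseteq> univ M \<and> card Q \<le> c)"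
    using bounded_settling_step[OF fin, of s B] by (elim exE)
  show ?case
  proof (intro exI[of _ c] allI impI)
    fix M :: "'r lstruct"
    assume M: "\<not> splits L M s \<and> finite (univ M) \<and> univ M \<noteq> {}"
    obtain D where D: "(\<forall>j<i. settles L M (D j) (D (Suc j))) \<and> D i \<noteq> {} \<and> D i \<subseteq> univ M \<and> card (D i) \<le> B"
      using mp[OF spec[OF B] M] by (elim exE)
    have "\<not> splits L M s \<and> finite (univ M) \<and> D i \<noteq> {} \<and> D i \<subseteq> univ M \<and> card (D i) \<le> B"
      using M D by simp
    from mp[OF spec[OF spec[OF c]] this] obtain Q
      where Q: "settles L M (D i) Q \<and> Q \<subseteq> univ M \<and> card Q \<le> c" by (elim exE)
    have "Q \<noteq> {}" using Q D by (auto simp: settles_def)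
    with D Q show "\<exists>D. (\<forall>j<Suc i. settles L M (D j) (D (Suc j))) \<and> D (Suc i) \<noteq> {} \<and>
        D (Suc i) \<subseteq> univ M \<and> card (D (Suc i)) \<le> c"
      by (intro exI[of _ "D(Suc i := Q)"]) (auto simp: less_Suc_eq)
  qed
qed

section \<open>Structures determined over a small set\<close>

text \<open>
  The maps \<open>f\<close> below lead from \<open>z\<close> to exactly the tuples of the same equality type over \<open>D\<close>.
\<close>

definition determined_over :: "'r lang \<Rightarrow> 'r lstruct \<Rightarrow> nat set \<Rightarrow> bool" where
  "determined_over L M D \<longleftrightarrow> (\<forall>R\<in>syms L. \<forall>z\<in>tuples (arity L R) (univ M). \<forall>f.
     inj_on f (set z) \<and> f ` set z \<subseteq> univ M \<and> (\<forall>v\<in>set z. v \<in> D \<or> f v \<in> D \<longrightarrow> f v = v) \<longrightarrow>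
     (z \<in> interp M R \<longleftrightarrow> map f z \<in> interp M R))"

lemma determined_overD:
  assumes "determined_over L M D" and "R \<in> syms L" and "z \<in> tuples (arity L R) (univ M)"
    and "inj_on f (set z)" "f ` set z \<subseteq> univ M" "\<forall>v\<in>set z. v \<in> D \<or> f v \<in> D \<longrightarrow> f v = v"
  shows "z \<in> interp M R \<longleftrightarrow> map f z \<in> interp M R"
  using assms(1) unfolding determined_over_def
  by (elim ballE[of _ _ R] ballE[of _ _ z] allE[of _ f]) (use assms in auto)

text \<open>
  Since the arity is smaller than the length of the chain, a tuple misses some layer
  \<open>D (i + 1) - D i\<close>. Its entries in \<open>D i\<close> act as parameters, and the truth value does not depend
  on the others.
\<close>

lemma determined_over_chain:
  assumes fin: "finite (syms L)"
    and D: "\<forall>j<arity_bound L. settles L M (D j) (D (Suc j))"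
  shows "determined_over L M (D (arity_bound L))"
  unfolding determined_over_def
proof (intro ballI allI impI)
  define q where "q = arity_bound L"
  fix R z f
  assume R: "R \<in> syms L" and z: "z \<in> tuples (arity L R) (univ M)"
    and f: "inj_on f (set z) \<and> f ` set z \<subseteq> univ M \<and>
      (\<forall>v\<in>set z. v \<in> D (arity_bound L) \<or> f v \<in> D (arity_bound L) \<longrightarrow> f v = v)"
  have step: "D j \<subseteq> D (Suc j)" if "j < q" for j
    using D that by (simp add: settles_def q_def)
  have mono: "D i \<subseteq> D j" if "i \<le> j" "j \<le> q" for i j
    using that
  proof (induction j rule: dec_induct)
    case (step n)
    then show ?case using \<open>\<And>j. j < q \<Longrightarrow> D j \<subseteq> D (Suc j)\<close>[of n] by auto
  qed simp
  show "z \<in> interp M R \<longleftrightarrow> map f z \<in> interp M R"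
  proof (cases "set z \<subseteq> D q")
    case True
    then have "map f z = z" using f by (auto simp: q_def intro!: map_idI)
    then show ?thesis by simp
  next
    case False
    have "\<exists>i<q. set z \<inter> D (Suc i) \<subseteq> D i"
    proof (rule ccontr)
      assume "\<not> ?thesis"
      then have "\<forall>i<q. \<exists>x. x \<in> set z \<and> x \<in> D (Suc i) \<and> x \<notin> D i" by blast
      then obtain g where g: "\<And>i. i < q \<Longrightarrow> g i \<in> set z \<and> g i \<in> D (Suc i) \<and> g i \<notin> D i" by metis
      have lt: "g i \<noteq> g j" if "i < j" "j < q" for i j
        using g[of i] g[of j] mono[of "Suc i" j] that by auto
      have "inj_on g {..<q}"
        by (rule linorder_inj_onI) (use lt in auto)
      then have "q \<le> card (set z)"
        using card_inj_on_le[of g "{..<q}" "set z"] g by auto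
      also have "\<dots> \<le> arity L R" using z card_length[of z] by (simp add: tuples_def)
      also have "\<dots> < q" using arity_less_bound[OF fin R] by (simp add: q_def)
      finally show False by simp
    qed
    then obtain i where i: "i < q" "set z \<inter> D (Suc i) \<subseteq> D i" by blast
    \<comment> \<open>\<open>z\<close> is read as an instance of a template: its entries in
      \<open>D i\<close> become parameters, the others become variables pointing into
      \<open>e\<close>. Removing repetitions makes \<open>e\<close> distinct.\<close>
    define e where "e = remdups (filter (\<lambda>v. v \<notin> D i) z)"
    have sete: "set e = set z - D i" by (auto simp: e_def)
    have "\<exists>j<length e. e ! j = v" if "v \<in> set z - D i" for v
      using that by (simp add: in_set_conv_nth flip: sete)
    then obtain ix where ix: "\<And>v. v \<in> set z - D i \<Longrightarrow> ix v < length e \<and> e ! ix v = v" by metis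
    define ts where "ts = map (\<lambda>v. if v \<in> D i then Par v else Var (ix v)) z"
    have k: "length e \<in> {1..arity_bound L}"
    proof -
      have "set e \<noteq> {}" using False mono[of i q] i(1) by (auto simp: sete)
      then have "1 \<le> length e" by (cases e) auto
      moreover have "length e \<le> length z"
        unfolding e_def using length_remdups_leq[of "filter (\<lambda>v. v \<notin> D i) z"] length_filter_le[of "\<lambda>v. v \<notin> D i" z] by linarith
      moreover have "length z \<le> arity_bound L"
        using z arity_less_bound[OF fin R] by (simp add: tuples_def)
      ultimately show ?thesis by simp
    qed
    have ts: "ts \<in> templates L R (length e) (D i)"
      using z ix by (auto simp: ts_def templates_def tuples_def)
    obtain v where v: "\<forall>e'\<in>tuples (length e) (univ M - D (Suc i)). distinct e' \<longrightarrow>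
        (plug e' ts \<in> interp M R \<longleftrightarrow> v)"
    proof -
      have "settles L M (D i) (D (Suc i))" using D i(1) by (simp add: q_def)
      then show ?thesis using R k ts that unfolding settles_def by meson
    qed
    have e1: "e \<in> tuples (length e) (univ M - D (Suc i))" "distinct e"
      using z i(2) by (auto simp: tuples_def sete) (simp add: e_def)
    have sub: "D i \<subseteq> D q" "D (Suc i) \<subseteq> D q" using mono i(1) by auto
    have e2: "map f e \<in> tuples (length e) (univ M - D (Suc i))" "distinct (map f e)"
    proof -
      \<comment> \<open>An entry that \<open>f\<close> sends into \<open>D (Suc i)\<close> is fixed
        by \<open>f\<close>, so it lies in \<open>D (Suc i)\<close> itself and by the choice of
        \<open>i\<close> in \<open>D i\<close>, contrary to \<open>x \<in> set e\<close>.\<close>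
      have "f x \<notin> D (Suc i)" if "x \<in> set e" for x
      proof
        assume a: "f x \<in> D (Suc i)"
        have "x \<in> set z" "x \<notin> D i" using that by (auto simp: sete)
        moreover have "f x = x" using f a sub(2) \<open>x \<in> set z\<close> by (auto simp: q_def)
        ultimately show False using a i(2) by auto
      qed
      then show "map f e \<in> tuples (length e) (univ M - D (Suc i))"
        using f sete by (auto simp: tuples_def)
      show "distinct (map f e)"
        using e1(2) f sete by (auto simp: distinct_map intro: inj_on_subset)
    qed
    have "plug e ts = z"
      using ix by (auto simp: plug_def ts_def intro!: map_idI)
    moreover have "plug (map f e) ts = map f z"
      using ix f sub(1) by (auto simp: plug_def ts_def q_def)
    ultimately show ?thesis using v e1 e2 by metis
  qed
qed

lemma bounded_determining_set:
  assumes fin: "finite (syms L)" and her: "hereditary L H"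
    and ns: "\<And>M. M \<in> H \<Longrightarrow> \<not> splits L M s"
  obtains B where "\<And>M. M \<in> H \<Longrightarrow> \<exists>D\<subseteq>univ M. card D \<le> B \<and> determined_over L M D"
proof -
  obtain B where B: "\<forall>M. \<not> splits L M s \<and> finite (univ M) \<and> univ M \<noteq> {} \<longrightarrow>
    (\<exists>D. (\<forall>j<arity_bound L. settles L M (D j) (D (Suc j))) \<and> D (arity_bound L) \<noteq> {} \<and>
      D (arity_bound L) \<subseteq> univ M \<and> card (D (arity_bound L)) \<le> B)"
    using bounded_settling_chain[OF fin, of s "arity_bound L"] by (elim exE)
  have "\<exists>D\<subseteq>univ M. card D \<le> B \<and> determined_over L M D" if "M \<in> H" for M
  proof -
    have "finite (univ M)" "univ M \<noteq> {}"
      using her that by (auto simp: hereditary_def is_lstruct_def)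
    then have M: "\<not> splits L M s \<and> finite (univ M) \<and> univ M \<noteq> {}" using ns[OF that] by simp
    obtain D where D: "(\<forall>j<arity_bound L. settles L M (D j) (D (Suc j))) \<and> D (arity_bound L) \<noteq> {} \<and>
      D (arity_bound L) \<subseteq> univ M \<and> card (D (arity_bound L)) \<le> B"
      using mp[OF spec[OF B] M] by (elim exE)
    then show ?thesis using determined_over_chain[OF fin conjunct1[OF D]] by blast
  qed
  then show ?thesis by (rule that)
qed

section \<open>Polynomial upper bound on the speed\<close>

lemma interp_sub_tuples:
  assumes "hereditary L H" and "M \<in> members_on H n"
  shows "R \<in> syms L \<Longrightarrow> interp M R \<subseteq> tuples (arity L R) {1..n}" 
    and "R \<notin> syms L \<Longrightarrow> interp M R = {}"
proof -
  have "is_lstruct L M" "univ M = {1..n}"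
    using assms by (simp_all add: members_on_def hereditary_def)
  then show "R \<in> syms L \<Longrightarrow> interp M R \<subseteq> tuples (arity L R) {1..n}"
    and "R \<notin> syms L \<Longrightarrow> interp M R = {}"
    by (simp_all add: is_lstruct_def)
qed

lemma members_on_eqI:
  assumes her: "hereditary L H" and M: "M \<in> members_on H n" "N \<in> members_on H n"
    and eq: "\<And>R. R \<in> syms L \<Longrightarrow> interp M R = interp N R"
  shows "M = N"
proof -
  have "interp M = interp N"
    using eq interp_sub_tuples(2)[OF her M(1)] interp_sub_tuples(2)[OF her M(2)] by (metis ext)
  then show ?thesis using M by (simp add: members_on_def)
qed

text \<open>Codes the restriction to \<open>W\<close> as one set of symbol-tuple pairs, so that
  structures can be counted inside a finite power set.\<close>

definition relations_within :: "'r lang \<Rightarrow> nat set \<Rightarrow> 'r lstruct \<Rightarrow> ('r \<times> nat list) set" where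
  "relations_within L W M = (SIGMA R:syms L. {z \<in> interp M R. set z \<subseteq> W})"

text \<open>Since \<open>card\<close> is 0 on infinite sets, both speed bounds need this
  finiteness.\<close>

lemma finite_members_on:
  assumes fin: "finite (syms L)" and her: "hereditary L H"
  shows "finite (members_on H n)"
proof (rule inj_on_finite)
  show "inj_on (relations_within L {1..n}) (members_on H n)"
  proof (rule inj_onI)
    fix M N assume M: "M \<in> members_on H n" and N: "N \<in> members_on H n"
      and eq: "relations_within L {1..n} M = relations_within L {1..n} N"
    show "M = N"
    proof (rule members_on_eqI[OF her M N])
      fix R assume R: "R \<in> syms L"
      have "{z \<in> interp M R. set z \<subseteq> {1..n}} = {z \<in> interp N R. set z \<subseteq> {1..n}}"
        using eq R by (auto simp: relations_within_def)
      then show "interp M R = interp N R"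
        using interp_sub_tuples(1)[OF her M R] interp_sub_tuples(1)[OF her N R]
        by (auto simp: tuples_def)
    qed
  qed
  show "relations_within L {1..n} ` members_on H n \<subseteq> Pow (SIGMA R:syms L. tuples (arity L R) {1..n})"
    using interp_sub_tuples(1)[OF her] by (fastforce simp: relations_within_def)
  show "finite (Pow (SIGMA R:syms L. tuples (arity L R) {1..n}))"
    using fin by (intro iffD2[OF finite_Pow_iff] finite_SigmaI finite_tuples) auto
qed

text \<open>
  A structure determined over \<open>D\<close> is recovered from its restriction to \<open>D\<close> and
  \<open>arity_bound L\<close> further elements.
\<close>

lemma card_members_determined_over:
  assumes fin: "finite (syms L)" and her: "hereditary L H"
    and D: "D \<subseteq> {1..n}" "card D \<le> B" and n: "B + arity_bound L \<le> n"
  shows "card {M \<in> members_on H n. determined_over L M D} \<le>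
    2 ^ (\<Sum>R\<in>syms L. (B + arity_bound L) ^ arity L R)"
proof -
  define q where "q = arity_bound L"
  have finD: "finite D" using D(1) finite_subset by auto
  \<comment> \<open>\<open>F\<close> is a reserve of elements outside \<open>D\<close>, large enough
    to receive injectively the entries of any tuple that lie outside \<open>D\<close>.\<close>
  have "q \<le> card ({1..n} - D)" using D n finD by (simp add: card_Diff_subset q_def)
  then obtain F where F: "F \<subseteq> {1..n} - D" "card F = q" "finite F"
    by (rule obtain_subset_with_card_n)
  define W where "W = D \<union> F"
  have finW: "finite W" using finD F by (simp add: W_def)
  have cW: "card W \<le> B + q" unfolding W_def using card_Un_le[of D F] D F by simp
  define K where "K = (SIGMA R:syms L. tuples (arity L R) W)"
  have finK: "finite K" unfolding K_def using fin finW by (intro finite_SigmaI finite_tuples) auto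
  have sub: "interp M R \<subseteq> interp N R"
    if M: "M \<in> members_on H n" "determined_over L M D"
      and N: "N \<in> members_on H n" "determined_over L N D"
      and eq: "relations_within L W M = relations_within L W N" and R: "R \<in> syms L" for M N R
  proof
    fix z assume z: "z \<in> interp M R"
    have zt: "z \<in> tuples (arity L R) {1..n}" using interp_sub_tuples(1)[OF her M(1) R] z by blast
    have "card (set z - D) \<le> card F"
    proof -
      have "card (set z - D) \<le> card (set z)" by (simp add: card_mono)
      also have "\<dots> \<le> arity L R" using card_length[of z] zt by (simp add: tuples_def)
      finally show ?thesis using arity_less_bound[OF fin R] F(2) by (simp add: q_def)
    qed
    then obtain g where g: "g ` (set z - D) \<subseteq> F" "inj_on g (set z - D)"
      using card_le_inj[of "set z - D" F] F(3) by auto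
    \<comment> \<open>\<open>f\<close> fixes \<open>D\<close> and moves the other entries into
      \<open>F\<close>, so it preserves the equality type over \<open>D\<close>. Membership of
      \<open>z\<close> thus reduces to that of \<open>map f z\<close>, on which \<open>M\<close> and
      \<open>N\<close> agree.\<close>
    define f where "f v = (if v \<in> D then v else g v)" for v
    have gF: "g v \<in> F" if "v \<in> set z" "v \<notin> D" for v using g(1) that by auto
    have f: "inj_on f (set z)" "f ` set z \<subseteq> {1..n}" "\<forall>v\<in>set z. v \<in> D \<or> f v \<in> D \<longrightarrow> f v = v"
    proof -
      show "inj_on f (set z)"
      proof (rule inj_onI)
        fix x y assume xy: "x \<in> set z" "y \<in> set z" "f x = f y"
        show "x = y"
          using xy gF[of x] gF[of y] F(1) inj_onD[OF g(2), of x y] by (auto simp: f_def split: if_splits)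
      qed
      show "f ` set z \<subseteq> {1..n}" using gF F(1) D(1) by (auto simp: f_def)
      show "\<forall>v\<in>set z. v \<in> D \<or> f v \<in> D \<longrightarrow> f v = v" using gF F(1) by (auto simp: f_def)
    qed
    have M': "univ M = {1..n}" "univ N = {1..n}" using M N by (auto simp: members_on_def)
    have "map f z \<in> interp M R"
      using determined_overD[OF M(2) R _ f(1) _ f(3)] zt f(2) z M' by simp
    moreover have "set (map f z) \<subseteq> W" using gF by (auto simp: f_def W_def)
    ultimately have "(R, map f z) \<in> relations_within L W N" unfolding eq[symmetric]
      using R by (simp add: relations_within_def)
    then have "map f z \<in> interp N R" by (simp add: relations_within_def)
    then show "z \<in> interp N R"
      using determined_overD[OF N(2) R _ f(1) _ f(3)] zt f(2) M' by simp
  qed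
  have "card {M \<in> members_on H n. determined_over L M D} \<le> card (Pow K)"
  proof (rule card_inj_on_le)
    show "inj_on (relations_within L W) {M \<in> members_on H n. determined_over L M D}"
    proof (rule inj_onI)
      fix M N
      assume M: "M \<in> {M \<in> members_on H n. determined_over L M D}"
        and N: "N \<in> {M \<in> members_on H n. determined_over L M D}"
        and eq: "relations_within L W M = relations_within L W N"
      show "M = N"
      proof (rule members_on_eqI[OF her])
        show "interp M R = interp N R" if "R \<in> syms L" for R
        proof (rule subset_antisym)
          show "interp M R \<subseteq> interp N R" using M N eq that by (intro sub) auto
          show "interp N R \<subseteq> interp M R" using M N eq that by (intro sub) auto
        qed
      qed (use M N in auto)
    qed
    show "relations_within L W ` {M \<in> members_on H n. determined_over L M D} \<subseteq> Pow K"
      using interp_sub_tuples(1)[OF her] by (fastforce simp: relations_within_def K_def tuples_def)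
  qed (simp add: finK)
  also have "\<dots> = 2 ^ (\<Sum>R\<in>syms L. card W ^ arity L R)"
    unfolding K_def using fin finW by (simp add: card_Pow finite_tuples card_tuples)
  also have "\<dots> \<le> 2 ^ (\<Sum>R\<in>syms L. (B + arity_bound L) ^ arity L R)"
    using cW by (intro power_increasing sum_mono power_mono) (auto simp: q_def)
  finally show ?thesis .
qed

text \<open>Each such subset is listed by a list of length \<open>B\<close>, padded with 0, which
  lies outside \<open>{1..n}\<close>.\<close>

lemma card_small_subsets: "card {D. D \<subseteq> {1..n} \<and> card D \<le> B} \<le> (n + 1) ^ B"
proof -
  have "{D. D \<subseteq> {1..n} \<and> card D \<le> B} \<subseteq> (\<lambda>xs. set xs \<inter> {1..n}) ` tuples B {0..n}"
  proof
    fix D assume D: "D \<in> {D. D \<subseteq> {1..n} \<and> card D \<le> B}"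
    then have finD: "finite D" using finite_subset by auto
    define xs where "xs = sorted_list_of_set D @ replicate (B - card D) 0"
    have "xs \<in> tuples B {0..n}" "set xs \<inter> {1..n} = D"
      using D finD by (auto simp: xs_def tuples_def)
    then show "D \<in> (\<lambda>xs. set xs \<inter> {1..n}) ` tuples B {0..n}" by blast
  qed
  from surj_card_le[OF finite_tuples this]
  have "card {D. D \<subseteq> {1..n} \<and> card D \<le> B} \<le> card (tuples B {0..n})" by simp
  then show ?thesis by (simp add: card_tuples)
qed

text \<open>Union bound over the possible determining sets \<open>D\<close>: each one admits at most
  a constant number of structures.\<close>

lemma polynomial_speed:
  assumes fin: "finite (syms L)" and her: "hereditary L H"
    and B: "\<And>M. M \<in> H \<Longrightarrow> \<exists>D\<subseteq>univ M. card D \<le> B \<and> determined_over L M D"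
  shows "\<exists>K::real. K > 0 \<and>
    (\<forall>\<^sub>F n in sequentially. real (card (members_on H n)) \<le> real n powr K)"
proof -
  define c :: nat where "c = 2 ^ (\<Sum>R\<in>syms L. (B + arity_bound L) ^ arity L R)"
  \<comment> \<open>For \<open>n \<ge> 2\<close> and \<open>n \<ge> c\<close> the count
    \<open>(n + 1) ^ B * c\<close> is at most \<open>(n * n) ^ B * n\<close>, whence the
    exponent.\<close>
  have bound: "card (members_on H n) \<le> n ^ (2 * B + 1)"
    if n: "B + arity_bound L + c + 2 \<le> n" for n
  proof -
    define DD where "DD = {D. D \<subseteq> {1..n} \<and> card D \<le> B}"
    have finDD: "finite DD" unfolding DD_def by (rule finite_subset[of _ "Pow {1..n}"]) auto
    have "members_on H n \<subseteq> (\<Union>D\<in>DD. {M \<in> members_on H n. determined_over L M D})"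
    proof
      fix M assume M: "M \<in> members_on H n"
      then show "M \<in> (\<Union>D\<in>DD. {M \<in> members_on H n. determined_over L M D})"
        using B[of M] by (auto simp: DD_def members_on_def)
    qed
    then have "card (members_on H n) \<le> card (\<Union>D\<in>DD. {M \<in> members_on H n. determined_over L M D})"
      using finDD finite_members_on[OF fin her] by (intro card_mono finite_UN_I) auto
    also have "\<dots> \<le> (\<Sum>D\<in>DD. card {M \<in> members_on H n. determined_over L M D})"
      by (rule card_UN_le[OF finDD])
    also have "\<dots> \<le> (\<Sum>D\<in>DD. c)"
      unfolding c_def using n by (intro sum_mono card_members_determined_over[OF fin her]) (auto simp: DD_def)
    also have "\<dots> = card DD * c" by simp
    also have "\<dots> \<le> (n + 1) ^ B * n"
      unfolding DD_def using n by (intro mult_mono card_small_subsets) auto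
    also have "\<dots> \<le> (n * n) ^ B * n"
    proof -
      have "n + 1 \<le> 2 * n" using n by simp
      also have "\<dots> \<le> n * n" using n by (intro mult_right_mono) auto
      finally show ?thesis by (intro mult_right_mono power_mono) auto
    qed
    also have "\<dots> = n ^ (2 * B + 1)" by (simp add: power_mult power2_eq_square)
    finally show ?thesis .
  qed
  have "real (card (members_on H n)) \<le> real n powr real (2 * B + 1)"
    if n: "B + arity_bound L + c + 2 \<le> n" for n
  proof -
    have "real (card (members_on H n)) \<le> real (n ^ (2 * B + 1))"
      using bound[OF n] of_nat_le_iff by blast
    also have "\<dots> = real n powr real (2 * B + 1)"
      using n by (subst powr_realpow) auto
    finally show ?thesis .
  qed
  then have "\<forall>\<^sub>F n in sequentially. real (card (members_on H n)) \<le> real n powr real (2 * B + 1)"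
    by (auto simp: eventually_sequentially)
  then show ?thesis by (intro exI[of _ "real (2 * B + 1)"]) auto
qed

section \<open>Types over a single parameter tuple\<close>

text \<open>Every formula of \<open>F\<close> true at a realization of \<open>p\<close> can be added
  consistently, so by maximality it is in \<open>p\<close>; one of \<open>\<chi>\<close> and its
  negation is true there.\<close>

lemma maximal_consistent_complete:
  assumes mc: "maximal_consistent L P n F p" and \<chi>: "\<chi> \<in> F" "Neg \<chi> \<in> F"
  shows "\<chi> \<in> p \<or> Neg \<chi> \<in> p"
proof -
  obtain M b where M: "is_lstruct L M" "realizes P n M b p" and pF: "p \<subseteq> F"
    using mc by (auto simp: maximal_consistent_def consistent_def)
  have "\<theta> \<in> p" if "\<theta> \<in> F" "sat M ((!) b) \<theta>" for \<theta>
  proof (rule ccontr)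
    assume "\<theta> \<notin> p"
    then have "p \<subset> insert \<theta> p" "insert \<theta> p \<subseteq> F" using that pF by auto
    moreover have "consistent L P n (insert \<theta> p)"
      using M that by (auto simp: consistent_def realizes_def)
    ultimately show False using mc by (auto simp: maximal_consistent_def)
  qed
  from this[of \<chi>] this[of "Neg \<chi>"] \<chi> show ?thesis by auto
qed

text \<open>A larger subset of \<open>F\<close> contains a false formula, hence some formula
  together with its negation. The condition on \<open>F\<close> covers both a formula paired with
  its negation and the set of all equality formulas.\<close>

lemma maximal_consistent_true_formulas:
  assumes M: "is_lstruct L M" "P \<subseteq> univ M" "b \<in> tuples n (univ M)"
    and F: "\<And>\<chi>. \<chi> \<in> F \<Longrightarrow> Neg \<chi> \<in> F \<or> (\<exists>\<theta>\<in>F. \<chi> = Neg \<theta>)"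
  shows "maximal_consistent L P n F {\<chi> \<in> F. sat M ((!) b) \<chi>}"
  unfolding maximal_consistent_def
proof (intro conjI allI impI)
  show "consistent L P n {\<chi> \<in> F. sat M ((!) b) \<chi>}"
    using M by (auto simp: consistent_def realizes_def)
  fix q assume q: "{\<chi> \<in> F. sat M ((!) b) \<chi>} \<subset> q \<and> q \<subseteq> F"
  then obtain \<chi> where \<chi>: "\<chi> \<in> q" "\<chi> \<in> F" "\<not> sat M ((!) b) \<chi>" by blast
  have true: "\<theta> \<in> q" if "\<theta> \<in> F" "sat M ((!) b) \<theta>" for \<theta> using q that by blast
  from F[OF \<chi>(2)] have "\<exists>\<theta>. \<theta> \<in> q \<and> Neg \<theta> \<in> q"
  proof (elim disjE bexE)
    assume "Neg \<chi> \<in> F"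
    then show ?thesis using \<chi> true[of "Neg \<chi>"] by (intro exI[of _ \<chi>]) simp
  next
    fix \<theta> assume "\<theta> \<in> F" "\<chi> = Neg \<theta>"
    then show ?thesis using \<chi> true[of \<theta>] by (intro exI[of _ \<theta>]) simp
  qed
  then obtain \<theta> where "\<theta> \<in> q" "Neg \<theta> \<in> q" by blast
  then show "\<not> consistent L P n q"
    unfolding consistent_def realizes_def by (metis sat.simps(4))
qed auto

definition lit :: "('r, pvar) qf \<Rightarrow> nat list \<Rightarrow> bool \<Rightarrow> ('r, nat trm) qf" where
  "lit \<phi> a v = (if v then inst \<phi> a else Neg (inst \<phi> a))"

lemma phi_type_cases:
  assumes "phi_type L k \<phi> {a} p"
  obtains v where "p = {lit \<phi> a v}"
proof -
  have "inst \<phi> a \<in> p \<or> Neg (inst \<phi> a) \<in> p"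
    using assms unfolding phi_type_def by (rule maximal_consistent_complete) auto
  moreover have "\<not> (inst \<phi> a \<in> p \<and> Neg (inst \<phi> a) \<in> p)" "p \<subseteq> {inst \<phi> a, Neg (inst \<phi> a)}"
  proof -
    have "consistent L (set a) k p" and "p \<subseteq> {inst \<phi> a, Neg (inst \<phi> a)}"
      using assms by (auto simp: phi_type_def maximal_consistent_def underlying_def)
    then obtain M b where "\<forall>\<psi>\<in>p. sat M ((!) b) \<psi>"
      unfolding consistent_def realizes_def by blast
    then show "\<not> (inst \<phi> a \<in> p \<and> Neg (inst \<phi> a) \<in> p)" by (meson sat.simps(4))
    show "p \<subseteq> {inst \<phi> a, Neg (inst \<phi> a)}" by fact
  qed
  ultimately have "p = {lit \<phi> a True} \<or> p = {lit \<phi> a False}"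
    by (auto simp: lit_def)
  then show ?thesis using that by blast
qed

lemma phi_type_lit:
  assumes "is_lstruct L M" and "realizes (set a) k M b {lit \<phi> a v}"
  shows "phi_type L k \<phi> {a} {lit \<phi> a v}"
proof -
  have "maximal_consistent L (set a) k {inst \<phi> a, Neg (inst \<phi> a)}
      {\<chi> \<in> {inst \<phi> a, Neg (inst \<phi> a)}. sat M ((!) b) \<chi>}"
    using assms by (intro maximal_consistent_true_formulas) (auto simp: realizes_def)
  moreover have "{\<chi> \<in> {inst \<phi> a, Neg (inst \<phi> a)}. sat M ((!) b) \<chi>} = {lit \<phi> a v}"
    using assms(2) by (auto simp: realizes_def lit_def)
  ultimately show ?thesis by (simp add: phi_type_def underlying_def insert_commute)
qed

text \<open>One valuation evaluates all the disjoint copies at once, so a union of copied types can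
  be tested under it.\<close>

lemma sat_copy: "sat M (\<lambda>(i, j). b i ! j) (copy i \<psi>) \<longleftrightarrow> sat M ((!) (b i)) \<psi>"
proof -
  have t: "trm_val (\<lambda>(i, j). b i ! j) (map_trm (Pair i) t) = trm_val ((!) (b i)) t" for t
    by (cases t) auto
  show ?thesis unfolding copy_def by (induction \<psi>) (auto simp: t comp_def)
qed

definition realizes_pattern ::
    "'r lstruct set \<Rightarrow> nat \<Rightarrow> ('r, pvar) qf \<Rightarrow> nat \<Rightarrow> nat list \<Rightarrow> ('r, nat trm) qf set \<Rightarrow> nat set \<Rightarrow> bool" where
  "realizes_pattern H k \<phi> m a \<rho> I \<longleftrightarrow> (\<exists>M\<in>H. \<exists>b. inj_on b {..<m} \<and>
     (\<forall>i<m. realizes (set a) k M (b i) {lit \<phi> a (i \<in> I)}) \<and>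
     (\<forall>i<m. \<forall>j<m. i \<noteq> j \<longrightarrow> realizes (set a) (2 * k) M (b i @ b j) \<rho>))"

text \<open>Over a single parameter tuple a type is a choice of sign, so the elements of
  \<open>S_phi_m\<close> correspond to the realized subsets of \<open>{..<m}\<close>. The value
  \<open>2 ^ m\<close> means that all subsets are realized.\<close>

lemma card_S_phi_m_eq_iff:
  assumes her: "hereditary L H"
  shows "card (S_phi_m L H k \<phi> m {a} \<rho>) = 2 ^ m \<longleftrightarrow> (\<forall>I\<subseteq>{..<m}. realizes_pattern H k \<phi> m a \<rho> I)"
proof -
  define g where "g I = (\<Union>i<m. copy i ` {lit \<phi> a (i \<in> I)})" for I
  define RI where "RI = {I. I \<subseteq> {..<m} \<and> realizes_pattern H k \<phi> m a \<rho> I}"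
  have und: "underlying {a} = set a" by (simp add: underlying_def)
  have "S_phi_m L H k \<phi> m {a} \<rho> = g ` RI"
  proof (intro equalityI subsetI)
    fix x assume "x \<in> S_phi_m L H k \<phi> m {a} \<rho>"
    then obtain p M b where x: "x = (\<Union>i<m. copy i ` p i)"
      and p: "\<forall>i<m. p i \<in> S_phi L H k \<phi> {a}" and M: "M \<in> H" and b: "inj_on b {..<m}"
        "\<forall>i<m. realizes (set a) k M (b i) (p i)"
        "\<forall>i<m. \<forall>j<m. i \<noteq> j \<longrightarrow> realizes (set a) (2 * k) M (b i @ b j) \<rho>"
      unfolding S_phi_m_def und by (elim CollectE exE conjE bexE) (rule that)
    define I where "I = {i. i < m \<and> p i = {lit \<phi> a True}}"
    have pi: "p i = {lit \<phi> a (i \<in> I)}" if "i < m" for i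
    proof -
      have "phi_type L k \<phi> {a} (p i)" using p that by (simp add: S_phi_def)
      then obtain v where "p i = {lit \<phi> a v}" by (rule phi_type_cases)
      then show ?thesis using that by (cases v; simp add: I_def lit_def)
    qed
    have "x = g I" unfolding x g_def using pi by auto
    moreover have "realizes_pattern H k \<phi> m a \<rho> I"
      unfolding realizes_pattern_def using M b pi by (intro bexI[of _ M] exI[of _ b]) auto
    ultimately show "x \<in> g ` RI" by (auto simp: RI_def I_def)
  next
    fix x assume "x \<in> g ` RI"
    then obtain I M b where x: "x = g I" and M: "M \<in> H" and b: "inj_on b {..<m}"
        "\<forall>i<m. realizes (set a) k M (b i) {lit \<phi> a (i \<in> I)}"
        "\<forall>i<m. \<forall>j<m. i \<noteq> j \<longrightarrow> realizes (set a) (2 * k) M (b i @ b j) \<rho>"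
      by (auto simp: RI_def realizes_pattern_def)
    have "is_lstruct L M" using her M by (simp add: hereditary_def)
    then have "\<forall>i<m. {lit \<phi> a (i \<in> I)} \<in> S_phi L H k \<phi> {a}"
      unfolding S_phi_def und using phi_type_lit b(2) M by blast
    then show "x \<in> S_phi_m L H k \<phi> m {a} \<rho>"
      unfolding S_phi_m_def und x g_def using M b
      by - (rule CollectI, rule exI[of _ "\<lambda>i. {lit \<phi> a (i \<in> I)}"],
          intro conjI bexI[of _ M] exI[of _ b] refl)
  qed
  moreover have "inj_on g RI"
  proof -
    \<comment> \<open>The argument is semantic because copies of a formula without
      \<open>x\<close>-variables coincide. A realization of the pattern \<open>I\<close> satisfies
      all of \<open>g I = g J\<close>, in particular the literals at \<open>i\<close> for both
      patterns, which therefore have the same sign.\<close>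
    have sub: "I \<subseteq> J" if I: "I \<in> RI" and J: "J \<in> RI" and eq: "g I = g J" for I J
    proof
      fix i assume i: "i \<in> I"
      then have im: "i < m" using I by (auto simp: RI_def)
      obtain M b where b: "\<forall>i<m. realizes (set a) k M (b i) {lit \<phi> a (i \<in> I)}"
        using I by (auto simp: RI_def realizes_pattern_def)
      have "sat M (\<lambda>(i, j). b i ! j) \<theta>" if "\<theta> \<in> g I" for \<theta>
        using that b by (auto simp: g_def sat_copy realizes_def)
      moreover have "copy i (lit \<phi> a (i \<in> J)) \<in> g I" using im unfolding eq by (auto simp: g_def)
      moreover have "copy i (lit \<phi> a (i \<in> I)) \<in> g I" using im by (auto simp: g_def)
      ultimately have "sat M ((!) (b i)) (lit \<phi> a (i \<in> J))" "sat M ((!) (b i)) (lit \<phi> a (i \<in> I))"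
        using sat_copy by blast+
      then show "i \<in> J" using i by (auto simp: lit_def split: if_splits)
    qed
    show ?thesis by (rule inj_onI) (metis sub subset_antisym)
  qed
  ultimately have "card (S_phi_m L H k \<phi> m {a} \<rho>) = card RI" by (simp add: card_image)
  moreover have "RI \<subseteq> Pow {..<m}" by (auto simp: RI_def)
  moreover have "card (Pow {..<m}) = 2 ^ m" by (simp add: card_Pow)
  ultimately have "card (S_phi_m L H k \<phi> m {a} \<rho>) = 2 ^ m \<longleftrightarrow> RI = Pow {..<m}"
    using card_subset_eq[of "Pow {..<m}" RI] by auto
  then show ?thesis by (auto simp: RI_def)
qed

section \<open>Finite dual dimension\<close>

text \<open>Sending the value of a term under \<open>s\<close> to its value under \<open>s'\<close>
  is well defined, injective and trivial over \<open>D\<close>, so \<open>determined_over\<close>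
  applies to every atom.\<close>

lemma sat_determined_over:
  assumes det: "determined_over L M D" and "wf_qf L \<phi>"
    and "\<And>t. t \<in> terms \<phi> \<Longrightarrow> trm_val s t \<in> univ M \<and> trm_val s' t \<in> univ M"
    and "\<And>t u. t \<in> terms \<phi> \<Longrightarrow> u \<in> terms \<phi> \<Longrightarrow> trm_val s t = trm_val s u \<longleftrightarrow> trm_val s' t = trm_val s' u"
    and "\<And>t. t \<in> terms \<phi> \<Longrightarrow> trm_val s t \<in> D \<or> trm_val s' t \<in> D \<Longrightarrow> trm_val s t = trm_val s' t"
  shows "sat M s \<phi> \<longleftrightarrow> sat M s' \<phi>"
  using assms(2-)
proof (induction \<phi>)
  case (Atom R ts)
  define f where "f v = trm_val s' (SOME t. t \<in> set ts \<and> trm_val s t = v)" for v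
  have f: "f (trm_val s t) = trm_val s' t" if "t \<in> set ts" for t
  proof -
    define u where "u = (SOME u. u \<in> set ts \<and> trm_val s u = trm_val s t)"
    have "u \<in> set ts \<and> trm_val s u = trm_val s t"
      unfolding u_def by (rule someI[of _ t]) (simp add: that)
    then have "trm_val s' u = trm_val s' t" using Atom.prems(3)[of u t] that by simp
    then show ?thesis by (simp add: f_def u_def)
  qed
  have eq: "map f (map (trm_val s) ts) = map (trm_val s') ts" using f by simp
  have "map (trm_val s) ts \<in> interp M R \<longleftrightarrow> map f (map (trm_val s) ts) \<in> interp M R"
  proof (rule determined_overD[OF det])
    show "R \<in> syms L" "map (trm_val s) ts \<in> tuples (arity L R) (univ M)"
      using Atom.prems(1,2) by (auto simp: tuples_def)
    show "inj_on f (set (map (trm_val s) ts))"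
      using Atom.prems(3) f by (auto simp: inj_on_def)
    show "f ` set (map (trm_val s) ts) \<subseteq> univ M" using Atom.prems(2) f by auto
    show "\<forall>v\<in>set (map (trm_val s) ts). v \<in> D \<or> f v \<in> D \<longrightarrow> f v = v"
      using Atom.prems(4)[symmetric] f by auto
  qed
  then show ?case unfolding eq by simp
qed auto

lemma S_empty_Equal:
  assumes \<rho>: "\<rho> \<in> S_empty n A" and b: "realizes (underlying A) n M b \<rho>" "realizes (underlying A) n M b' \<rho>"
    and t: "t \<in> Var ` {..<n} \<union> Par ` underlying A" "u \<in> Var ` {..<n} \<union> Par ` underlying A"
  shows "trm_val ((!) b) t = trm_val ((!) b) u \<longleftrightarrow> trm_val ((!) b') t = trm_val ((!) b') u"
proof -
  have "Equal t u \<in> \<rho> \<or> Neg (Equal t u) \<in> \<rho>"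
    using \<rho> t unfolding S_empty_def by (intro maximal_consistent_complete) auto
  then show ?thesis using b by (fastforce simp: realizes_def)
qed

text \<open>
  By \<open>\<rho>\<close>, and as \<open>m \<ge> 3\<close>, each position is either constant along the tuples \<open>b i\<close> (\<open>common\<close>
  in the proof) or its entries occur in one tuple only. Hence at most \<open>card D\<close> tuples have an entry
  in \<open>D\<close> at a position that is not constant.
\<close>

lemma no_large_alternating_pattern:
  assumes det: "determined_over L M D" and D: "finite D" "card D \<le> B"
    and \<phi>: "pformula L k (length a) \<phi>" and a: "set a \<subseteq> univ M"
    and \<rho>: "\<rho> \<in> S_empty (2 * k) {a}" and m: "2 * B + 3 \<le> m"
    and b: "\<And>i. i < m \<Longrightarrow> b i \<in> tuples k (univ M)"
    and b\<rho>: "\<And>i j. i < m \<Longrightarrow> j < m \<Longrightarrow> i \<noteq> j \<Longrightarrow> realizes (set a) (2 * k) M (b i @ b j) \<rho>"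
    and alt: "\<And>i. i < m \<Longrightarrow> sat M ((!) (b i)) (inst \<phi> a) \<longleftrightarrow> i \<le> B"
  shows False
proof -
  have und: "underlying {a} = set a" by (simp add: underlying_def)
  have len: "length (b i) = k" if "i < m" for i using b[OF that] by (simp add: tuples_def)
  have E: "trm_val ((!) (b i @ b j)) t = trm_val ((!) (b i @ b j)) u \<longleftrightarrow>
      trm_val ((!) (b i' @ b j')) t = trm_val ((!) (b i' @ b j')) u"
    if "i < m" "j < m" "i \<noteq> j" "i' < m" "j' < m" "i' \<noteq> j'"
      "t \<in> Var ` {..<2 * k} \<union> Par ` set a" "u \<in> Var ` {..<2 * k} \<union> Par ` set a" for i j i' j' t u
    using S_empty_Equal[OF \<rho>, of M "b i @ b j" "b i' @ b j'" t u] b\<rho> that unfolding und by blast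
  have cross: "b i ! p = b j ! r \<longleftrightarrow> b i' ! p = b j' ! r"
    if "i < m" "j < m" "i \<noteq> j" "i' < m" "j' < m" "i' \<noteq> j'" "p < k" "r < k" for i j i' j' p r
    using E[of i j i' j' "Var p" "Var (k + r)"] that by (simp add: nth_append len)
  \<comment> \<open>\<open>\<rho>\<close> speaks only about pairs of different tuples. Statements
    about a single tuple borrow a second index, and comparisons of two tuples a third, available as
    \<open>m \<ge> 3\<close>.\<close>
  have other: "\<exists>l<m. l \<noteq> i \<and> l \<noteq> j" for i j
  proof -
    have "card {i, j} < card {..<3::nat}" by (cases "i = j") auto
    then have "\<not> {..<3} \<subseteq> {i, j}" by (meson card_mono finite.intros not_le)
    then obtain l where "l < 3" "l \<noteq> i" "l \<noteq> j" by auto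
    then show ?thesis using m by (intro exI[of _ l]) auto
  qed
  have within: "b i ! p = b i ! r \<longleftrightarrow> b j ! p = b j ! r" if "i < m" "j < m" "p < k" "r < k" for i j p r
  proof -
    obtain i' j' where "i' < m" "i' \<noteq> i" "j' < m" "j' \<noteq> j" using other by blast
    then show ?thesis
      using E[of i i' j j' "Var p" "Var r"] that by (simp add: nth_append len)
  qed
  have param: "b i ! p = c \<longleftrightarrow> b j ! p = c" if "i < m" "j < m" "p < k" "c \<in> set a" for i j p c
  proof -
    obtain i' j' where "i' < m" "i' \<noteq> i" "j' < m" "j' \<noteq> j" using other by blast
    then show ?thesis
      using E[of i i' j j' "Var p" "Par c"] that by (simp add: nth_append len)
  qed
  define common where "common p \<longleftrightarrow> b 0 ! p = b 1 ! p" for p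
  have common: "b i ! p = b j ! p \<longleftrightarrow> common p" if "i < m" "j < m" "i \<noteq> j" "p < k" for i j p
    unfolding common_def using that m by (intro cross) auto
  \<comment> \<open>By \<open>\<rho>\<close> the value \<open>b i ! p\<close> equals
    \<open>b l ! r\<close> for a third index \<open>l\<close> as well, so position \<open>r\<close>
    agrees in two different tuples and is constant.\<close>
  have meet_common: "common r" if "i < m" "j < m" "i \<noteq> j" "p < k" "r < k" "b i ! p = b j ! r" for i j p r
  proof -
    obtain l where l: "l < m" "l \<noteq> i" "l \<noteq> j" using other by blast
    have "b i ! p = b l ! r" using cross[of i j i l p r] that l by simp
    then show ?thesis using common[of j l r] that l by simp
  qed
  define hit where "hit = {i. i < m \<and> (\<exists>p<k. \<not> common p \<and> b i ! p \<in> D)}"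
  have "\<forall>i\<in>hit. \<exists>p. p < k \<and> \<not> common p \<and> b i ! p \<in> D" by (auto simp: hit_def)
  from bchoice[OF this] obtain w where w: "\<forall>i\<in>hit. w i < k \<and> \<not> common (w i) \<and> b i ! w i \<in> D"
    by blast
  have "card hit \<le> card D"
  proof (rule card_inj_on_le[of "\<lambda>i. b i ! w i"])
    show "inj_on (\<lambda>i. b i ! w i) hit"
    proof (rule inj_onI, rule ccontr)
      fix i j assume ij: "i \<in> hit" "j \<in> hit" "b i ! w i = b j ! w j" "i \<noteq> j"
      then show False using meet_common[of i j "w i" "w j"] w by (auto simp: hit_def)
    qed
  qed (use w D in auto)
  then have chit: "card hit < B + 1" using D by simp
  have finh: "finite hit" by (simp add: hit_def)
  have avoid: "\<exists>i\<in>J. i \<notin> hit" if "B + 1 \<le> card J" for J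
  proof (rule ccontr)
    assume "\<not> ?thesis"
    then have "card J \<le> card hit" using finh by (intro card_mono) auto
    then show False using chit that by simp
  qed
  \<comment> \<open>There are \<open>B + 1\<close> indices with value true and at least
    \<open>B + 2\<close> with value false, but \<open>hit\<close> has at most \<open>B\<close>
    elements, so each side has an index outside it.\<close>
  obtain i where i: "i \<le> B" "i \<notin> hit" using avoid[of "{..B}"] by auto
  obtain j where j: "B < j" "j < m" "j \<notin> hit" using avoid[of "{B<..<m}"] m by force
  have im: "i < m" using i m by simp
  define h where "h = case_pvar Var (\<lambda>j. Par (a ! j) :: nat trm)"
  have ti: "terms (inst \<phi> a) \<subseteq> Var ` {..<k} \<union> Par ` set a"
    using \<phi> by (auto simp: inst_def qf.set_map pformula_def split: pvar.splits)
  have wfm: "wf_qf L (subst_qf h \<psi>) = wf_qf L \<psi>" for \<psi>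
    by (induction \<psi>) auto
  have "sat M ((!) (b i)) (inst \<phi> a) \<longleftrightarrow> sat M ((!) (b j)) (inst \<phi> a)"
  proof (rule sat_determined_over[OF det])
    show "wf_qf L (inst \<phi> a)" using wfm[of \<phi>] \<phi> by (simp add: inst_def h_def pformula_def)
    fix t assume "t \<in> terms (inst \<phi> a)"
    then have t: "t \<in> Var ` {..<k} \<union> Par ` set a" using ti by blast
    show "trm_val ((!) (b i)) t \<in> univ M \<and> trm_val ((!) (b j)) t \<in> univ M"
      using t b[OF im] b[OF j(2)] a by (auto simp: tuples_def)
    show "trm_val ((!) (b i)) t = trm_val ((!) (b j)) t"
      if "trm_val ((!) (b i)) t \<in> D \<or> trm_val ((!) (b j)) t \<in> D"
      using t that i j im common[of i j] by (auto simp: hit_def)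
    fix u assume "u \<in> terms (inst \<phi> a)"
    then have u: "u \<in> Var ` {..<k} \<union> Par ` set a" using ti by blast
    show "trm_val ((!) (b i)) t = trm_val ((!) (b i)) u \<longleftrightarrow> trm_val ((!) (b j)) t = trm_val ((!) (b j)) u"
      using t u within[OF im j(2)] param[OF im j(2)] by (elim UnE imageE; simp; metis)
  qed
  then show False using alt[OF im] alt[OF j(2)] i j by simp
qed

text \<open>A count of \<open>2 ^ m\<close> would realize the pattern \<open>{..B}\<close>, which
  \<open>no_large_alternating_pattern\<close> excludes for \<open>m \<ge> 2 * B + 3\<close>. The
  bound is the same for all formulas.\<close>

lemma VC0_finite:
  assumes her: "hereditary L H"
    and B: "\<And>M. M \<in> H \<Longrightarrow> \<exists>D\<subseteq>univ M. card D \<le> B \<and> determined_over L M D"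
  shows "VC0 L H < \<infinity>"
proof -
  have bound: "m \<le> 2 * B + 2"
    if \<phi>: "pformula L k l \<phi>" and m: "1 \<le> m" and box: "zero_box l S A" and \<rho>: "\<rho> \<in> S_empty (2 * k) A"
      and card: "card (S_phi_m L H k \<phi> m A \<rho>) = 2 ^ m" for k l \<phi> m S A \<rho>
  proof (rule ccontr)
    assume large: "\<not> m \<le> 2 * B + 2"
    show False
    proof (cases "l = 0")
      case True
      \<comment> \<open>Over the empty box only the empty type exists, so there is at most one
        union, fewer than \<open>2 ^ m\<close> as \<open>m \<ge> 1\<close>.\<close>
      then have "A = {}" using box by (simp add: zero_box_def)
      then have "p = {}" if "p \<in> S_phi L H k \<phi> A" for p
        using that by (auto simp: S_phi_def phi_type_def maximal_consistent_def)
      then have "S_phi_m L H k \<phi> m A \<rho> \<subseteq> {{}}" by (fastforce simp: S_phi_m_def)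
      then have "card (S_phi_m L H k \<phi> m A \<rho>) \<le> card {{} :: ('a, (nat \<times> nat) trm) qf set}"
        by (intro card_mono) auto
      moreover have "(2::nat) ^ m > 1" using m by (intro one_less_power) auto
      ultimately show False using card by simp
    next
      case False
      then obtain a where a: "A = {a}" "length a = l"
        using box by (auto simp: zero_box_def tuples_def)
      have "realizes_pattern H k \<phi> m a \<rho> {..B}"
        using card_S_phi_m_eq_iff[OF her, of k \<phi> m a \<rho>] card[unfolded a] large by (auto dest!: spec[of _ "{..B}"])
      then obtain M b where M: "M \<in> H" and b: "\<forall>i<m. realizes (set a) k M (b i) {lit \<phi> a (i \<in> {..B})}"
          "\<forall>i<m. \<forall>j<m. i \<noteq> j \<longrightarrow> realizes (set a) (2 * k) M (b i @ b j) \<rho>"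
        unfolding realizes_pattern_def by blast
      obtain D where D: "D \<subseteq> univ M" "card D \<le> B" "determined_over L M D" using B[OF M] by blast
      have "finite D" using D(1) her M finite_subset by (auto simp: hereditary_def)
      moreover have "set a \<subseteq> univ M" using b(1) m by (auto simp: realizes_def)
      ultimately show False
        using no_large_alternating_pattern[OF D(3) _ D(2), of k a \<phi> \<rho> m b] \<phi> \<rho> large b a
        by (auto simp: realizes_def lit_def split: if_splits)
    qed
  qed
  have "VC0_phi L H k l \<phi> \<le> enat (2 * B + 2)" if "pformula L k l \<phi>" for k l \<phi>
    unfolding VC0_phi_def using bound[OF that] by (intro Sup_least) auto
  then have "VC0 L H \<le> enat (2 * B + 2)"
    unfolding VC0_def by (intro Sup_least) auto
  then show ?thesis using enat_ord_simps(4) le_less_trans by blast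
qed

section \<open>Infinite dual dimension from splits\<close>

text \<open>No atoms occur over \<open>eq_lang\<close>, so the two structures may differ; this
  transfers an equality type from a structure without relations to \<open>M\<close>.\<close>

lemma sat_equality_formula:
  assumes "wf_qf eq_lang \<chi>"
    and "\<And>t u. t \<in> terms \<chi> \<Longrightarrow> u \<in> terms \<chi> \<Longrightarrow> trm_val s t = trm_val s u \<longleftrightarrow> trm_val s' t = trm_val s' u"
  shows "sat M s \<chi> \<longleftrightarrow> sat N s' \<chi>"
  using assms
proof (induction \<chi>)
  case (Equal t u)
  show ?case using Equal(2)[of t u] by simp
next
  case (Conj \<chi> \<psi>)
  have "sat M s \<chi> \<longleftrightarrow> sat N s' \<chi>" "sat M s \<psi> \<longleftrightarrow> sat N s' \<psi>"
    using Conj.prems by (auto intro!: Conj.IH)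
  then show ?case by simp
qed (simp_all add: eq_lang_def)

lemma trm_val_eq_iff_distinct:
  assumes "distinct e" and "set e \<inter> P = {}"
    and "t \<in> Var ` {..<length e} \<union> Par ` P" "u \<in> Var ` {..<length e} \<union> Par ` P"
  shows "trm_val ((!) e) t = trm_val ((!) e) u \<longleftrightarrow> t = u"
proof -
  have "e ! i \<noteq> d" if "i < length e" "d \<in> P" for i d
    using that assms(2) nth_mem[of i e] by (auto simp: disjoint_iff)
  then show ?thesis
    using assms(1,3,4) by (elim UnE imageE) (auto simp: nth_eq_iff_index_eq)
qed

text \<open>At each place \<open>i < m\<close> the pattern \<open>I\<close> chooses between the true
  tuple \<open>b i\<close> and the false tuple \<open>b (m + i)\<close>. Any two chosen tuples are
  disjoint, distinct and off \<open>P\<close>, so all pairs share one equality type over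
  \<open>P\<close>.\<close>

lemma VC0_ge_of_splits:
  assumes her: "hereditary L H" and M: "M \<in> H" and split: "splits L M m" and m: "2 \<le> m"
  shows "enat m \<le> VC0 L H"
proof -
  obtain R k P ts b where R: "R \<in> syms L" and k: "1 \<le> k" and P: "P \<noteq> {}" "P \<subseteq> univ M"
    and ts: "ts \<in> templates L R k P"
    and b: "\<And>i. i < 2 * m \<Longrightarrow> b i \<in> tuples k (univ M - P)" "\<And>i. i < 2 * m \<Longrightarrow> distinct (b i)"
      "\<And>i. i < 2 * m \<Longrightarrow> plug (b i) ts \<in> interp M R \<longleftrightarrow> i < m"
    and disj: "disjoint_family_on (\<lambda>i. set (b i)) {..<2 * m}"
    using split unfolding splits_def by blast
  have lM: "is_lstruct L M" and finP: "finite P"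
    using her M P finite_subset by (auto simp: hereditary_def)
  \<comment> \<open>All parameters are packed into one tuple, which forms the box; \<open>ix\<close>
    below gives each parameter its \<open>Y\<close>-variable.\<close>
  define a where "a = sorted_list_of_set P"
  define l where "l = length a"
  have a: "set a = P" and l: "l \<noteq> 0" using finP P by (auto simp: a_def l_def)
  have "\<forall>d\<in>P. \<exists>j. j < l \<and> a ! j = d" by (auto simp: l_def in_set_conv_nth simp flip: a)
  from bchoice[OF this] obtain ix where ix: "\<forall>d\<in>P. ix d < l \<and> a ! ix d = d" by blast
  define h where "h t = (case t of Var i \<Rightarrow> X i | Par d \<Rightarrow> Y (ix d))" for t
  define \<phi> where "\<phi> = Atom R (map h ts)"
  have tsset: "set ts \<subseteq> Var ` {..<k} \<union> Par ` P" and lents: "length ts = arity L R"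
    using ts by (auto simp: templates_def tuples_def)
  have \<phi>: "pformula L k l \<phi>"
    using tsset lents R ix by (fastforce simp: pformula_def \<phi>_def h_def)
  have inst: "inst \<phi> a = Atom R ts"
    using tsset ix by (auto simp: inst_def \<phi>_def h_def intro!: map_idI)
  define c where "c I i = b (if i \<in> I then i else m + i)" for I i
  have c: "c I i \<in> tuples k (univ M - P)" "distinct (c I i)"
      "plug (c I i) ts \<in> interp M R \<longleftrightarrow> i \<in> I" if "i < m" for I i
    using that b by (auto simp: c_def)
  have cdisj: "set (c I i) \<inter> set (c I j) = {}" if "i < m" "j < m" "i \<noteq> j" for I i j
    using that disjoint_family_onD[OF disj, of "if i \<in> I then i else m + i" "if j \<in> I then j else m + j"]
    by (auto simp: c_def split: if_splits)
  have pair: "distinct (c I i @ c I j)" "set (c I i @ c I j) \<inter> P = {}" "length (c I i @ c I j) = 2 * k"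
      "c I i @ c I j \<in> tuples (2 * k) (univ M)"
    if "i < m" "j < m" "i \<noteq> j" for I i j
    using c(1,2)[of i I] c(1,2)[of j I] cdisj[of i j I] that by (auto simp: tuples_def)
  define F where "F = {\<psi> :: ('a, nat trm) qf. wf_qf eq_lang \<psi> \<and> terms \<psi> \<subseteq> Var ` {..<2 * k} \<union> Par ` P}"
  \<comment> \<open>\<open>M\<close> may have relations and so need not be an \<open>eq_lang\<close>
    structure; its bare universe witnesses the consistency of \<open>\<rho>\<close>.\<close>
  define E where "E = (\<lparr>univ = univ M, interp = \<lambda>_. {}\<rparr> :: 'a lstruct)"
  define e where "e = c {} 0 @ c {} 1"
  define \<rho> where "\<rho> = {\<chi> \<in> F. sat E ((!) e) \<chi>}"
  have e: "distinct e" "set e \<inter> P = {}" "length e = 2 * k" "e \<in> tuples (2 * k) (univ M)"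
    unfolding e_def using pair[of 0 1] m by auto
  have "maximal_consistent eq_lang P (2 * k) F \<rho>"
    unfolding \<rho>_def
  proof (rule maximal_consistent_true_formulas)
    show "is_lstruct eq_lang E"
      using lM by (auto simp: E_def is_lstruct_def eq_lang_def)
  qed (use P e in \<open>auto simp: E_def F_def\<close>)
  then have \<rho>: "\<rho> \<in> S_empty (2 * k) {a}"
    by (simp add: S_empty_def F_def underlying_def a)
  have "realizes_pattern H k \<phi> m a \<rho> I" for I
    unfolding realizes_pattern_def
  proof (intro bexI[OF _ M] exI[of _ "c I"] conjI allI impI)
    show "inj_on (c I) {..<m}"
    proof (rule inj_onI, rule ccontr)
      fix i j assume ij: "i \<in> {..<m}" "j \<in> {..<m}" "c I i = c I j" "i \<noteq> j"
      then have "set (c I i) = {}" using cdisj[of i j I] by auto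
      then show False using c(1)[of i I] ij k by (auto simp: tuples_def)
    qed
    fix i assume i: "i < m"
    show "realizes (set a) k M (c I i) {lit \<phi> a (i \<in> I)}"
      using c[OF i, of I] P a by (auto simp: realizes_def lit_def inst tuples_def plug_def)
    fix j assume j: "j < m" "i \<noteq> j"
    have "sat M ((!) (c I i @ c I j)) \<chi>" if "\<chi> \<in> \<rho>" for \<chi>
    proof -
      have "\<chi> \<in> F" and "sat E ((!) e) \<chi>" using that by (auto simp: \<rho>_def)
      moreover have "sat E ((!) e) \<chi> \<longleftrightarrow> sat M ((!) (c I i @ c I j)) \<chi>"
      proof (rule sat_equality_formula)
        show "wf_qf eq_lang \<chi>" using \<open>\<chi> \<in> F\<close> by (simp add: F_def)
        fix t u assume "t \<in> terms \<chi>" "u \<in> terms \<chi>"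
        then have tu: "t \<in> Var ` {..<2 * k} \<union> Par ` P" "u \<in> Var ` {..<2 * k} \<union> Par ` P"
          using \<open>\<chi> \<in> F\<close> by (auto simp: F_def)
        show "trm_val ((!) e) t = trm_val ((!) e) u \<longleftrightarrow>
            trm_val ((!) (c I i @ c I j)) t = trm_val ((!) (c I i @ c I j)) u"
          using trm_val_eq_iff_distinct[OF e(1,2), of t u]
            trm_val_eq_iff_distinct[OF pair(1)[OF i j, of I] pair(2)[OF i j, of I], of t u] tu e(3) pair(3)[OF i j, of I] by simp
      qed
      ultimately show ?thesis by simp
    qed
    then show "realizes (set a) (2 * k) M (c I i @ c I j) \<rho>"
      using pair(4)[OF i j] P a by (simp add: realizes_def)
  qed
  then have "card (S_phi_m L H k \<phi> m {a} \<rho>) = 2 ^ m"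
    by (simp add: card_S_phi_m_eq_iff[OF her])
  moreover have "zero_box l UNIV {a}" using l by (simp add: zero_box_def tuples_def l_def)
  ultimately have "enat m \<le> VC0_phi L H k l \<phi>"
    unfolding VC0_phi_def using m \<rho>
    by (intro Sup_upper CollectI exI[of _ m] conjI exI[of _ UNIV] exI[of _ "{a}"] exI[of _ \<rho>]) auto
  also have "\<dots> \<le> VC0 L H"
    unfolding VC0_def using \<phi> by (intro Sup_upper) blast
  finally show ?thesis .
qed

lemma VC0_infinite:
  assumes her: "hereditary L H" and split: "\<And>s. \<exists>M\<in>H. splits L M s"
  shows "VC0 L H = \<infinity>"
proof (cases "VC0 L H")
  case (enat x)
  obtain M where "M \<in> H" "splits L M (x + 2)" using split by blast
  then have "enat (x + 2) \<le> VC0 L H" by (intro VC0_ge_of_splits[OF her]) auto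
  then show ?thesis using enat by simp
qed

section \<open>Exponential lower bound on the speed\<close>

text \<open>The element \<open>i \<ge> 1\<close> of the pullback stands for the list entry \<open>u ! (i - 1)\<close>.\<close>

definition pullback :: "'r lang \<Rightarrow> 'r lstruct \<Rightarrow> nat list \<Rightarrow> 'r lstruct" where
  "pullback L M u = \<lparr>univ = {1..length u}, interp = (\<lambda>R. if R \<in> syms L
     then {z \<in> tuples (arity L R) {1..length u}. map (\<lambda>i. u ! (i - 1)) z \<in> interp M R} else {})\<rparr>"

text \<open>Positions in \<open>u\<close> give an isomorphism from the induced substructure on
  \<open>set u\<close>, so both closure properties of \<open>H\<close> apply.\<close>

lemma pullback_member:
  assumes her: "hereditary L H" and M: "M \<in> H" and u: "distinct u" "u \<noteq> []" "set u \<subseteq> univ M"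
  shows "pullback L M u \<in> members_on H (length u)"
proof -
  define g where "g i = u ! (i - 1)" for i
  have g: "bij_betw g {1..length u} (set u)"
    unfolding bij_betw_def
  proof
    show "inj_on g {1..length u}"
      using u(1) by (auto simp: g_def nth_eq_iff_index_eq intro!: inj_onI)
    show "g ` {1..length u} = set u"
    proof (intro equalityI subsetI)
      fix x assume "x \<in> set u"
      then obtain i where "i < length u" "u ! i = x" by (auto simp: in_set_conv_nth)
      then show "x \<in> g ` {1..length u}" by (intro image_eqI[of _ _ "Suc i"]) (auto simp: g_def)
    qed (auto simp: g_def)
  qed
  define f where "f = inv_into {1..length u} g"
  have f: "bij_betw f (set u) {1..length u}" unfolding f_def by (rule bij_betw_inv_into[OF g])
  have gf: "g (f x) = x" if "x \<in> set u" for x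
    unfolding f_def using bij_betw_inv_into_right[OF g that] .
  have "\<forall>M\<in>H. \<forall>S. S \<noteq> {} \<and> S \<subseteq> univ M \<longrightarrow> induced M S \<in> H"
    and iso: "\<forall>M\<in>H. \<forall>N. is_lstruct L N \<and> lstruct_iso L M N \<longrightarrow> N \<in> H"
    using her unfolding hereditary_def by blast+
  then have ind: "induced M (set u) \<in> H" using M u by simp
  have ne: "{1..length u} \<noteq> {}" using u(2) by (cases u) auto
  have "is_lstruct L (pullback L M u)"
    using ne by (auto simp: is_lstruct_def pullback_def)
  moreover have "lstruct_iso L (induced M (set u)) (pullback L M u)"
    unfolding lstruct_iso_def
  proof (intro exI[of _ f] conjI ballI)
    show "bij_betw f (univ (induced M (set u))) (univ (pullback L M u))"
      using f by (simp add: induced_def pullback_def)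
    fix R z assume R: "R \<in> syms L" and "z \<in> tuples (arity L R) (univ (induced M (set u)))"
    then have z: "length z = arity L R" "set z \<subseteq> set u" by (auto simp: induced_def tuples_def)
    have "map (\<lambda>i. u ! (i - 1)) (map f z) = z"
      using gf z(2) by (auto simp: g_def intro!: map_idI)
    moreover have "map f z \<in> tuples (arity L R) {1..length u}"
      using z bij_betw_imp_surj_on[OF f] by (auto simp: tuples_def)
    ultimately show "z \<in> interp (induced M (set u)) R \<longleftrightarrow> map f z \<in> interp (pullback L M u) R"
      using R z by (simp add: induced_def pullback_def del: map_map)
  qed
  ultimately have "pullback L M u \<in> H" using iso ind by blast
  then show ?thesis by (simp add: members_on_def pullback_def)
qed

lemma length_concat_uniform: "\<forall>x\<in>set xs. length x = k \<Longrightarrow> length (concat xs) = length xs * k"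
  by (induction xs) auto

lemma nth_concat_uniform:
  "\<forall>x\<in>set xs. length x = k \<Longrightarrow> i < length xs \<Longrightarrow> j < k \<Longrightarrow> concat xs ! (i * k + j) = xs ! i ! j"
proof (induction xs arbitrary: i)
  case (Cons x xs)
  then show ?case by (cases i) (auto simp: nth_append)
qed simp

text \<open>A pattern \<open>I\<close> on \<open>q\<close> blocks is laid out as a list
  \<open>u I\<close> of length \<open>n\<close>: the parameters, then one true or false tuple per
  block, then padding. The positions do not depend on \<open>I\<close>, so the labelled structure on
  \<open>{1..n}\<close> reveals \<open>I\<close>.\<close>

lemma speed_ge_of_splits:
  assumes fin: "finite (syms L)" and her: "hereditary L H" and M: "M \<in> H" and split: "splits L M (Suc n)"
    and n: "arity_bound L \<le> n"
  shows "\<exists>q. 2 ^ q \<le> card (members_on H n) \<and> n < (q + 2) * arity_bound L"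
proof -
  \<comment> \<open>With \<open>s = Suc n\<close> the index \<open>q \<le> n\<close> is below
    \<open>s\<close>, and the blocks use only indices below \<open>q\<close> or from
    \<open>s\<close> on; hence \<open>b q\<close> is free for padding.\<close>
  define s where "s = Suc n"
  obtain R k P ts b where R: "R \<in> syms L" and k: "1 \<le> k" "k \<le> arity_bound L" and P: "P \<subseteq> univ M"
    and ts: "ts \<in> templates L R k P"
    and b: "\<And>i. i < 2 * s \<Longrightarrow> b i \<in> tuples k (univ M - P)" "\<And>i. i < 2 * s \<Longrightarrow> distinct (b i)"
      "\<And>i. i < 2 * s \<Longrightarrow> plug (b i) ts \<in> interp M R \<longleftrightarrow> i < s"
    and disj: "disjoint_family_on (\<lambda>i. set (b i)) {..<2 * s}"
    using split unfolding splits_def s_def by blast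
  have tsset: "set ts \<subseteq> Var ` {..<k} \<union> Par ` P" and lents: "length ts = arity L R"
    using ts by (auto simp: templates_def tuples_def)
  \<comment> \<open>\<open>P\<close> may be arbitrarily large, but at most \<open>arity L R\<close>
    parameters occur in the template, and only these must enter the universe.\<close>
  define Q where "Q = {d. Par d \<in> set ts}"
  have QP: "Q \<subseteq> P" using tsset by (auto simp: Q_def)
  have injPar: "inj_on Par Q" by (rule inj_onI) simp
  have imQ: "Par ` Q \<subseteq> set ts" by (auto simp: Q_def)
  have finQ: "finite Q" using inj_on_finite[OF injPar imQ] by simp
  have "card Q \<le> card (set ts)" by (rule card_inj_on_le[OF injPar imQ]) simp
  also have "\<dots> \<le> arity L R" using card_length[of ts] lents by simp
  finally have cQ: "card Q < arity_bound L" using arity_less_bound[OF fin R] by simp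
  define p where "p = sorted_list_of_set Q"
  define t where "t = length p"
  have p: "set p = Q" "distinct p" using finQ by (auto simp: p_def)
  have t: "t = card Q" by (simp add: t_def p_def)
  define q where "q = (n - t) div k"
  have qn: "q \<le> n" unfolding q_def by (meson diff_le_self div_le_dividend le_trans)
  have qk: "q * k \<le> n - t" by (simp add: q_def)
  have rem: "n - t < (q + 1) * k" using k by (simp add: q_def dividend_less_div_times)
  define c where "c I i = b (if i \<in> I then i else s + i)" for I i
  define blocks where "blocks I = map (c I) [0..<q]" for I
  \<comment> \<open>the last segment pads the universe to size \<open>n\<close> by part of an unused tuple\<close>
  define u where "u I = p @ concat (blocks I) @ take (n - t - q * k) (b q)" for I
  have idx: "(if i \<in> I then i else s + i) < 2 * s" if "i < q" for i I using that qn by (simp add: s_def)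
  have len_c: "length (c I i) = k" "set (c I i) \<subseteq> univ M - P" "distinct (c I i)" if "i < q" for I i
    using b(1,2)[OF idx[OF that, of I]] by (auto simp: c_def tuples_def)
  have len_q: "length (b q) = k" "set (b q) \<subseteq> univ M - P" "distinct (b q)"
    using b(1,2)[of q] qn by (auto simp: s_def tuples_def)
  have cdisj: "set (c I i) \<inter> set (c I j) = {}" if "i < q" "j < q" "i \<noteq> j" for I i j
    unfolding c_def using that idx[of i I] idx[of j I] qn
    by (intro disjoint_family_onD[OF disj]) (auto simp: s_def)
  have cdisj_q: "set (c I i) \<inter> set (b q) = {}" if "i < q" for I i
    unfolding c_def using that idx[of i I] qn
    by (intro disjoint_family_onD[OF disj]) (auto simp: s_def)
  have len_blocks: "\<forall>x\<in>set (blocks I). length x = k" for I using len_c by (auto simp: blocks_def)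
  have len_u: "length (u I) = n" for I
    using length_concat_uniform[OF len_blocks[of I]] qk rem n cQ t len_q(1)
    by (simp add: u_def blocks_def t_def[symmetric])
  have set_blocks: "set (concat (blocks I)) \<subseteq> univ M - P" for I
    by (simp add: blocks_def) (intro UN_least len_c(2); simp)
  have take_sub: "set (take (n - t - q * k) (b q)) \<subseteq> set (b q)" by (rule set_take_subset)
  have u_sub: "set (u I) \<subseteq> univ M" for I
    using set_blocks[of I] take_sub len_q(2) p(1) QP P by (auto simp: u_def)
  have dist_u: "distinct (u I)" for I
  proof -
    have "distinct (concat (blocks I))"
    proof (rule distinct_concat)
      show "distinct (blocks I)"
        unfolding blocks_def distinct_map
      proof (intro conjI inj_onI, simp, rule ccontr)
        fix i j assume ij: "i \<in> set [0..<q]" "j \<in> set [0..<q]" "c I i = c I j" "i \<noteq> j"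
        then have "set (c I i) = {}" using cdisj[of i j I] by auto
        then show False using len_c(1)[of i I] ij k by auto
      qed
      show "distinct ys" if "ys \<in> set (blocks I)" for ys using that len_c(3) by (auto simp: blocks_def)
      show "set ys \<inter> set zs = {}" if yz: "ys \<in> set (blocks I)" "zs \<in> set (blocks I)" "ys \<noteq> zs" for ys zs
      proof -
        obtain i where "i < q" "ys = c I i" using yz(1) by (auto simp: blocks_def)
        moreover obtain j where "j < q" "zs = c I j" using yz(2) by (auto simp: blocks_def)
        ultimately show ?thesis using cdisj[of i j I] yz(3) by blast
      qed
    qed
    moreover have "set (concat (blocks I)) \<inter> set (b q) = {}"
      unfolding disjoint_iff
    proof (intro allI impI)
      fix x assume "x \<in> set (concat (blocks I))"
      then obtain i where "i < q" "x \<in> set (c I i)" by (auto simp: blocks_def)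
      with cdisj_q[of i I] show "x \<notin> set (b q)" by blast
    qed
    moreover have "set p \<inter> (univ M - P) = {}" using p QP by auto
    ultimately show ?thesis
      unfolding u_def using p(2) len_q set_blocks[of I] take_sub by (auto simp del: set_concat)
  qed
  have "\<forall>d\<in>Q. \<exists>j. j < t \<and> p ! j = d" by (auto simp: t_def in_set_conv_nth simp flip: p(1))
  from bchoice[OF this] obtain ix where ix: "\<forall>d\<in>Q. ix d < t \<and> p ! ix d = d" by blast
  \<comment> \<open>Where the value of a template term in block \<open>i\<close> sits in
    \<open>u I\<close>; \<open>Suc\<close> shifts from list indices to labels in
    \<open>{1..n}\<close>.\<close>
  define pos where "pos i x = (case x of Var j \<Rightarrow> Suc (t + (i * k + j)) | Par d \<Rightarrow> Suc (ix d))" for i x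
  have pos: "pos i x \<in> {1..n} \<and> u I ! (pos i x - 1) = trm_val ((!) (c I i)) x"
    if i: "i < q" and x: "x \<in> set ts" for i x I
  proof (cases x)
    case (Var j)
    then have j: "j < k" using x tsset by auto
    have "i * k + j < (i + 1) * k" using j by simp
    also have "\<dots> \<le> q * k" using i by (intro mult_right_mono) auto
    finally have lt: "i * k + j < q * k" .
    then have "pos i x \<in> {1..n}" using Var qk by (simp add: pos_def)
    moreover have "u I ! (t + (i * k + j)) = concat (blocks I) ! (i * k + j)"
      using lt length_concat_uniform[OF len_blocks[of I]]
      by (simp add: u_def nth_append t_def[symmetric] blocks_def)
    moreover have "concat (blocks I) ! (i * k + j) = c I i ! j"
      using nth_concat_uniform[OF len_blocks[of I], of i j] i j by (simp add: blocks_def)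
    ultimately show ?thesis using Var by (simp add: pos_def)
  next
    case (Par d)
    then have d: "ix d < t" "p ! ix d = d" using x ix by (auto simp: Q_def)
    have "t \<le> n" using t cQ n by simp
    then show ?thesis using d Par by (simp add: pos_def u_def nth_append t_def[symmetric])
  qed
  have read: "map (pos i) ts \<in> interp (pullback L M (u I)) R \<longleftrightarrow> i \<in> I" if i: "i < q" for i I
  proof -
    have "map (pos i) ts \<in> tuples (arity L R) {1..n}" using pos[OF i] lents by (auto simp: tuples_def)
    moreover have "map (\<lambda>i. u I ! (i - 1)) (map (pos i) ts) = plug (c I i) ts"
      using pos[OF i] by (simp add: plug_def)
    moreover have "plug (c I i) ts \<in> interp M R \<longleftrightarrow> i \<in> I"
      using b(3)[OF idx[OF i, of I]] i qn by (simp add: c_def s_def)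
    ultimately show ?thesis using R by (simp add: pullback_def len_u del: map_map)
  qed
  have "card (Pow {..<q}) \<le> card (members_on H n)"
  proof (rule card_inj_on_le)
    show "inj_on (\<lambda>I. pullback L M (u I)) (Pow {..<q})"
    proof (rule inj_onI)
      fix I J assume IJ: "I \<in> Pow {..<q}" "J \<in> Pow {..<q}" "pullback L M (u I) = pullback L M (u J)"
      have "i \<in> I \<longleftrightarrow> i \<in> J" if "i < q" for i using read[OF that, of I] read[OF that, of J] IJ(3) by simp
      then show "I = J" using IJ(1,2) by auto
    qed
    have "u I \<noteq> []" for I using len_u[of I] n by (auto simp: arity_bound_def)
    then show "(\<lambda>I. pullback L M (u I)) ` Pow {..<q} \<subseteq> members_on H n"
      using pullback_member[OF her M dist_u _ u_sub] by (auto simp: len_u)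
  qed (rule finite_members_on[OF fin her])
  then have "2 ^ q \<le> card (members_on H n)" by (simp add: card_Pow)
  moreover have "n < (q + 2) * arity_bound L"
  proof -
    have "n < (q + 1) * k + t" using rem by simp
    also have "\<dots> \<le> (q + 1) * arity_bound L + arity_bound L"
      using k cQ t by (intro add_mono mult_left_mono) auto
    finally show ?thesis by (simp add: algebra_simps)
  qed
  ultimately show ?thesis by blast
qed

lemma exponential_speed:
  assumes fin: "finite (syms L)" and her: "hereditary L H" and split: "\<And>s. \<exists>M\<in>H. splits L M s"
  shows "\<exists>C::real. C > 0 \<and>
    (\<forall>\<^sub>F n in sequentially. real (card (members_on H n)) \<ge> 2 powr (C * real n))"
proof -
  define r where "r = arity_bound L"
  have r: "1 \<le> r" by (simp add: r_def arity_bound_def)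
  have "2 powr (1 / (2 * real r) * real n) \<le> real (card (members_on H n))" if n: "4 * r \<le> n" for n
  proof -
    obtain M where M: "M \<in> H" "splits L M (Suc n)" using split by blast
    obtain q where q: "2 ^ q \<le> card (members_on H n)" "n < (q + 2) * r"
      using speed_ge_of_splits[OF fin her M] n by (auto simp: r_def)
    \<comment> \<open>As \<open>2 * r\<close> is at most half of \<open>n\<close>, the bound
      \<open>n < (q + 2) * r\<close> leaves at least half of \<open>n\<close> to
      \<open>q * r\<close>; this gives the constant \<open>1 / (2 * r)\<close>.\<close>
    have "n \<le> 2 * (q * r)" using q(2) n by (simp add: algebra_simps)
    then have "real n \<le> 2 * (real q * real r)" by (metis of_nat_le_iff of_nat_mult of_nat_numeral)
    then have "1 / (2 * real r) * real n \<le> real q" using r by (simp add: field_simps)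
    then have "2 powr (1 / (2 * real r) * real n) \<le> 2 powr real q" by simp
    also have "\<dots> = real (2 ^ q)" by (simp add: powr_realpow)
    also have "\<dots> \<le> real (card (members_on H n))" using q(1) of_nat_le_iff by blast
    finally show ?thesis .
  qed
  then have "\<forall>\<^sub>F n in sequentially. real (card (members_on H n)) \<ge> 2 powr (1 / (2 * real r) * real n)"
    by (auto simp: eventually_sequentially)
  then show ?thesis using r by (intro exI[of _ "1 / (2 * real r)"]) auto
qed

section \<open>Assembling the two sides of the dichotomy\<close>

theorem theorem3:
  fixes L :: "'r lang" and H :: "'r lstruct set"
  assumes "finite (syms L)" and "hereditary L H"
  shows "(VC0 L H < \<infinity> \<and>
           (\<exists>K::real. K > 0 \<and>
             (\<forall>\<^sub>F n in sequentially. real (card (members_on H n)) \<le> real n powr K))) \<or>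
         (VC0 L H = \<infinity> \<and>
           (\<exists>C::real. C > 0 \<and>
             (\<forall>\<^sub>F n in sequentially. real (card (members_on H n)) \<ge> 2 powr (C * real n))))"
proof (cases "\<forall>s. \<exists>M\<in>H. splits L M s")
  case True
  then show ?thesis using VC0_infinite[OF assms(2)] exponential_speed[OF assms] by blast
next
  case False
  \<comment> \<open>One \<open>s\<close> fails for all members at once, so a single \<open>B\<close>
    serves both the dimension bound and the count.\<close>
  then obtain s where "\<And>M. M \<in> H \<Longrightarrow> \<not> splits L M s" by blast
  then obtain B where "\<And>M. M \<in> H \<Longrightarrow> \<exists>D\<subseteq>univ M. card D \<le> B \<and> determined_over L M D"
    using bounded_determining_set[OF assms] by blast
  then show ?thesis using VC0_finite[OF assms(2)] polynomial_speed[OF assms] by blast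
qed

end
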